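(* Let $\mathcal{M}$ be a non-degenerate motion of a pentagonal bipyramid $\mathbb{B}_5$ with fixed edge lengths, and let $\mathscr{G}\subseteq \mathbb{Z}_2^{5}$ be its Galois group, where the five entries are indexed by the equatorial edges $(1,2),(2,3),(3,4),(4,5),(5,1)$ in this order. Then, up to dihedral symmetry (i.e. up to relabeling the equatorial cycle $1,2,3,4,5$ by an element of the dihedral group of the $5$-cycle), $\mathscr{G}$ is one of the two groups $$\langle (1,1,1,1,1)\rangle \qquad\text{or}\qquad \langle (1,1,1,1,1),\,(1,0,1,0,0)\rangle .$$
   Context: $\mathbb{B}_5$ is the graph with vertex set $V=\{1,\dots,5,\mathsf T,\mathsf B\}$ and edges $\{i,i+1\}$ (mod $5$), $\{i,\mathsf T\}$, $\{i,\mathsf B\}$ for $i=1,\dots,5$. Let $\mathcal{E}_5=\{(1,2),(2,3),(3,4),(4,5),(5,1)\}$ be the oriented equatorial edges. A realization is a map $\rho:V\to\mathbb{R}^3$ with $\rho(u)\ne\rho(v)$ for every edge $\{u,v\}$; it induces edge lengths $\lambda_{uv}=\|\rho(u)-\rho(v)\|$. The oriented volume of $(a_1,a_2,a_3,a_4)$ is $\frac16\det(a_1-a_4,\ a_2-a_4,\ a_3-a_4)$. The oriented Cayley-Menger variety $\mathrm{CM}^*_5$ is the Zariski closure of the image of the map $(\mathbb{R}^3)^V\to\mathbb{R}^{\binom V2}\times\mathbb{R}^{\mathcal{E}_5}$, $\rho\mapsto((d_{vw}),(s_e))$, with $d_{vw}=\|\rho(v)-\rho(w)\|^2$ and $s_{i,i+1}$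 the oriented volume of the images of $(i,i+1,\mathsf T,\mathsf B)$ (indices mod $5$). For edge lengths $\lambda$, the configuration space is $K_\lambda=\mathrm{CM}^*_5\cap\{d_{vw}=\lambda_{vw}^2 \text{ for all edges } \{v,w\}\}$. A motion $\mathcal{M}$ is a one-dimensional (irreducible) component of $K_\lambda$ whose general point comes from a realization inducing $\lambda$. It is non-degenerate if the vertices of each $3$-cycle are non-collinear and for every non-edge $\{v,w\}$ the function $d_{vw}$ is non-constant on $\mathcal{M}$. For a non-degenerate motion, the rational map $d_{\mathsf T\mathsf B}:\mathcal{M}\dashrightarrow\mathbb{R}$ is non-constant and gives a field extension $\mathbb{R}(d_{\mathsf T\mathsf B})\subset\mathbb{R}(\mathcal{M})$ of function fields; its Galois group $\mathscr{G}$ is the group of automorphisms of $\mathbb{R}(\mathcal{M})$ fixing $\mathbb{R}(d_{\mathsf T\mathsf B})$. Every $\varphi\in\mathscr{G}$ satisfies $\varphi(s_e)=\pm s_e$ for all $e\in\mathcal{E}_5$ and is identified with the binary tuple in $\mathbb{Z}_2^{\mathcal{E}_5}$ whose entry at $e$ is $1$ iff $\varphi(s_e)=-s_e$. *)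

theory Defs
  imports
    "HOL-Analysis.Analysis"
    "HOL-Library.Z2"
    "HOL-Library.Extended_Nat"
    "HOL-Computational_Algebra.Group_Closure"
    "HOL-Algebra.QuotRing"
    "HOL-Algebra.Generated_Fields"
begin

section \<open>Zariski topology on a real Euclidean space\<close>

definition zariski_closed :: "'a::euclidean_space set \<Rightarrow> bool" where
  "zariski_closed S \<longleftrightarrow>
     (\<exists>F. (\<forall>f\<in>F. real_polynomial_function f) \<and> S = {x. \<forall>f\<in>F. f x = 0})"

definition zariski_closure :: "'a::euclidean_space set \<Rightarrow> 'a set" where
  "zariski_closure S = \<Inter> {C. zariski_closed C \<and> S \<subseteq> C}"

definition zariski_irreducible :: "'a::euclidean_space set \<Rightarrow> bool" where
  "zariski_irreducible S \<longleftrightarrow> S \<noteq> {} \<and>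
     (\<forall>A B. zariski_closed A \<longrightarrow> zariski_closed B \<longrightarrow> S \<subseteq> A \<union> B \<longrightarrow> S \<subseteq> A \<or> S \<subseteq> B)"

definition irreducible_component :: "'a::euclidean_space set \<Rightarrow> 'a set \<Rightarrow> bool" where
  "irreducible_component K M \<longleftrightarrow> M \<subseteq> K \<and> zariski_irreducible M \<and>
     (\<forall>N. N \<subseteq> K \<longrightarrow> zariski_irreducible N \<longrightarrow> M \<subseteq> N \<longrightarrow> N = M)"

text \<open>Krull dimension, for Zariski closed nonempty \<open>S\<close>.\<close>

definition zariski_dim :: "'a::euclidean_space set \<Rightarrow> enat" where
  "zariski_dim S = Sup {enat n | n. \<exists>C :: nat \<Rightarrow> 'a set.
     (\<forall>k\<le>n. zariski_closed (C k) \<and> zariski_irreducible (C k) \<and> C k \<subseteq> S) \<and>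
     (\<forall>k<n. C k \<subset> C (Suc k))}"


section \<open>Coordinate ring and function field\<close>

text \<open>Polynomial functions restricted to \<open>M\<close>; this is the polynomial ring modulo the
  vanishing ideal of \<open>M\<close>.\<close>

definition coordinate_ring :: "'a::euclidean_space set \<Rightarrow> ('a \<Rightarrow> real) ring" where
  "coordinate_ring M =
     \<lparr>carrier = (\<lambda>f. restrict f M) ` {f. real_polynomial_function f},
      mult = (\<lambda>f g. \<lambda>x\<in>M. f x * g x), one = (\<lambda>x\<in>M. 1),
      zero = (\<lambda>x\<in>M. 0), add = (\<lambda>f g. \<lambda>x\<in>M. f x + g x)\<rparr>"

definition fraction_rel :: "('a, 'm) ring_scheme \<Rightarrow> (('a \<times> 'a) \<times> ('a \<times> 'a)) set" where
  "fraction_rel R = {((a, b), (c, d)).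
     a \<in> carrier R \<and> b \<in> carrier R - {\<zero>\<^bsub>R\<^esub>} \<and> c \<in> carrier R \<and> d \<in> carrier R - {\<zero>\<^bsub>R\<^esub>} \<and>
     a \<otimes>\<^bsub>R\<^esub> d = c \<otimes>\<^bsub>R\<^esub> b}"

definition fraction :: "('a, 'm) ring_scheme \<Rightarrow> 'a \<Rightarrow> 'a \<Rightarrow> ('a \<times> 'a) set" where
  "fraction R a b = fraction_rel R `` {(a, b)}"

definition fraction_field :: "('a, 'm) ring_scheme \<Rightarrow> ('a \<times> 'a) set ring" where
  "fraction_field R =
     \<lparr>carrier = {fraction R a b | a b. a \<in> carrier R \<and> b \<in> carrier R - {\<zero>\<^bsub>R\<^esub>}},
      mult = (\<lambda>X Y. \<Union>(a, b)\<in>X. \<Union>(c, d)\<in>Y. fraction R (a \<otimes>\<^bsub>R\<^esub> c) (b \<otimes>\<^bsub>R\<^esub> d)),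
      one = fraction R \<one>\<^bsub>R\<^esub> \<one>\<^bsub>R\<^esub>,
      zero = fraction R \<zero>\<^bsub>R\<^esub> \<one>\<^bsub>R\<^esub>,
      add = (\<lambda>X Y. \<Union>(a, b)\<in>X. \<Union>(c, d)\<in>Y.
               fraction R (a \<otimes>\<^bsub>R\<^esub> d \<oplus>\<^bsub>R\<^esub> c \<otimes>\<^bsub>R\<^esub> b) (b \<otimes>\<^bsub>R\<^esub> d))\<rparr>"

abbreviation function_field :: "'a::euclidean_space set \<Rightarrow> (('a \<Rightarrow> real) \<times> ('a \<Rightarrow> real)) set ring"
  where "function_field M \<equiv> fraction_field (coordinate_ring M)"

text \<open>The class of a polynomial function in the function field.\<close>

definition regular :: "'a::euclidean_space set \<Rightarrow> ('a \<Rightarrow> real) \<Rightarrow> (('a \<Rightarrow> real) \<times> ('a \<Rightarrow> real)) set" where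
  "regular M f = fraction (coordinate_ring M) (restrict f M) (\<lambda>x\<in>M. 1)"

text \<open>Automorphisms of a field \<open>K\<close> fixing a subset \<open>k\<close> pointwise.\<close>

definition galois_automorphisms :: "('a, 'm) ring_scheme \<Rightarrow> 'a set \<Rightarrow> ('a \<Rightarrow> 'a) set" where
  "galois_automorphisms K k =
     {\<phi> \<in> ring_iso K K. \<phi> \<in> extensional (carrier K) \<and> (\<forall>x\<in>k. \<phi> x = x)}"


section \<open>The pentagonal bipyramid\<close>

text \<open>The equator is indexed by the type \<open>5\<close> of integers modulo 5, so that \<open>5 = 0\<close> and
  \<open>i + 1\<close> is the cyclic successor. The oriented equatorial edge \<open>(i, i + 1)\<close> is represented by
  its source \<open>i\<close>.\<close>

datatype vertex = Equator "5" | Top | Bottom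

lemma UNIV_vertex: "(UNIV :: vertex set) = range Equator \<union> {Top, Bottom}"
  by (auto intro: vertex.exhaust)

instance vertex :: finite
  by standard (simp add: UNIV_vertex)

definition edges :: "vertex set set" where
  "edges = (\<Union>i. {{Equator i, Equator (i + 1)}, {Equator i, Top}, {Equator i, Bottom}})"

typedef vpair = "{e :: vertex set. card e = 2}"
  by (rule exI [of _ "{Top, Bottom}"]) simp

instance vpair :: finite
proof
  have "(UNIV :: vpair set) \<subseteq> Abs_vpair ` UNIV"
    by (metis Rep_vpair_inverse rangeI subsetI)
  then show "finite (UNIV :: vpair set)"
    using finite_subset finite_imageI finite_class.finite_UNIV by metis
qed

type_synonym configuration = "vertex \<Rightarrow> real^3"

definition realization :: "configuration \<Rightarrow> bool" where
  "realization \<rho> \<longleftrightarrow> (\<forall>v w. {v, w} \<in> edges \<longrightarrow> \<rho> v \<noteq> \<rho> w)"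

definition induces :: "configuration \<Rightarrow> (vertex set \<Rightarrow> real) \<Rightarrow> bool" where
  "induces \<rho> lam \<longleftrightarrow> realization \<rho> \<and>
     (\<forall>v w. {v, w} \<in> edges \<longrightarrow> lam {v, w} = norm (\<rho> v - \<rho> w))"

definition oriented_volume :: "real^3 \<Rightarrow> real^3 \<Rightarrow> real^3 \<Rightarrow> real^3 \<Rightarrow> real" where
  "oriented_volume a1 a2 a3 a4 =
     1/6 * det (vector [a1 - a4, a2 - a4, a3 - a4] :: real^3^3)"


section \<open>The oriented Cayley-Menger variety and motions\<close>

type_synonym cm_space = "(real^vpair) \<times> (real^5)"

text \<open>The coordinate functions \<open>d\<^sub>v\<^sub>w\<close> (for \<open>v \<noteq> w\<close>) and \<open>s\<^sub>e\<close>.\<close>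

definition dcoord :: "vertex \<Rightarrow> vertex \<Rightarrow> cm_space \<Rightarrow> real" where
  "dcoord v w p = fst p $ Abs_vpair {v, w}"

definition scoord :: "5 \<Rightarrow> cm_space \<Rightarrow> real" where
  "scoord i p = snd p $ i"

definition cm_map :: "configuration \<Rightarrow> cm_space" where
  "cm_map \<rho> =
     (\<chi> e. (THE x. \<exists>v w. Rep_vpair e = {v, w} \<and> x = (norm (\<rho> v - \<rho> w))\<^sup>2),
      \<chi> i. oriented_volume (\<rho> (Equator i)) (\<rho> (Equator (i + 1))) (\<rho> Top) (\<rho> Bottom))"

lemma dcoord_cm_map: "v \<noteq> w \<Longrightarrow> dcoord v w (cm_map \<rho>) = (norm (\<rho> v - \<rho> w))\<^sup>2"
  by (auto simp: dcoord_def cm_map_def Abs_vpair_inverse doubleton_eq_iff norm_minus_commute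
      intro!: the_equality)

definition CM :: "cm_space set" where
  "CM = zariski_closure (range cm_map)"

definition configuration_space :: "(vertex set \<Rightarrow> real) \<Rightarrow> cm_space set" where
  "configuration_space lam =
     {p \<in> CM. \<forall>v w. {v, w} \<in> edges \<longrightarrow> dcoord v w p = (lam {v, w})\<^sup>2}"

text \<open>``The general point comes from a realization'' means that all points of some nonempty
  Zariski open subset \<open>M - Z\<close> do.\<close>

definition motion :: "(vertex set \<Rightarrow> real) \<Rightarrow> cm_space set \<Rightarrow> bool" where
  "motion lam M \<longleftrightarrow> irreducible_component (configuration_space lam) M \<and> zariski_dim M = 1 \<and>
     (\<exists>Z. zariski_closed Z \<and> \<not> M \<subseteq> Z \<and> (\<forall>p \<in> M - Z. \<exists>\<rho>. induces \<rho> lam \<and> p = cm_map \<rho>))"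

definition nondegenerate_motion :: "(vertex set \<Rightarrow> real) \<Rightarrow> cm_space set \<Rightarrow> bool" where
  "nondegenerate_motion lam M \<longleftrightarrow> motion lam M \<and>
     (\<forall>\<rho>. induces \<rho> lam \<longrightarrow> cm_map \<rho> \<in> M \<longrightarrow>
        (\<forall>u v w. {u, v} \<in> edges \<longrightarrow> {v, w} \<in> edges \<longrightarrow> {u, w} \<in> edges \<longrightarrow>
           \<not> collinear {\<rho> u, \<rho> v, \<rho> w})) \<and>
     (\<forall>v w. v \<noteq> w \<longrightarrow> {v, w} \<notin> edges \<longrightarrow> \<not> dcoord v w constant_on M)"


section \<open>The Galois group\<close>

text \<open>The subfield of the function field generated by the constants and \<open>d\<^sub>T\<^sub>B\<close>.\<close>

definition base_field :: "cm_space set \<Rightarrow> ((cm_space \<Rightarrow> real) \<times> (cm_space \<Rightarrow> real)) set set" where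
  "base_field M = generate_field (function_field M)
     (insert (regular M (dcoord Top Bottom)) (range (\<lambda>c. regular M (\<lambda>_. c))))"

definition sign_tuple ::
  "cm_space set \<Rightarrow> (((cm_space \<Rightarrow> real) \<times> (cm_space \<Rightarrow> real)) set \<Rightarrow>
     ((cm_space \<Rightarrow> real) \<times> (cm_space \<Rightarrow> real)) set) \<Rightarrow> bit^5" where
  "sign_tuple M \<phi> = (\<chi> i.
     if \<phi> (regular M (scoord i)) = \<ominus>\<^bsub>function_field M\<^esub> regular M (scoord i) then 1 else 0)"

text \<open>The group in the identification of an automorphism with its tuple of signs.\<close>

definition galois_group :: "cm_space set \<Rightarrow> (bit^5) set" where
  "galois_group M = sign_tuple M ` galois_automorphisms (function_field M) (base_field M)"

definition dihedral :: "(5 \<Rightarrow> 5) set" where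
  "dihedral = range (\<lambda>a i. a + i) \<union> range (\<lambda>a i. a - i)"

text \<open>The permutation of the (unoriented) equatorial edges induced by a relabeling of the
  equatorial vertices, and the resulting relabeling of tuples.\<close>

definition edge_perm :: "(5 \<Rightarrow> 5) \<Rightarrow> 5 \<Rightarrow> 5" where
  "edge_perm \<sigma> i = (THE j. {j, j + 1} = {\<sigma> i, \<sigma> (i + 1)})"

definition relabel :: "(5 \<Rightarrow> 5) \<Rightarrow> bit^5 \<Rightarrow> bit^5" where
  "relabel \<sigma> b = (\<chi> i. b $ edge_perm \<sigma> i)"

end

theory Submission
  imports Defs
begin

text \<open>
  Put \<open>t = d\<^sub>T\<^sub>B\<close>. Each \<open>s\<^sub>i\<^sup>2\<close> is a quadratic polynomial in \<open>t\<close> with negative leading coefficient,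
  and the diagonals \<open>d\<^sub>i\<^sub>,\<^sub>i\<^sub>+\<^sub>2\<close> are rational in \<open>t\<close> and \<open>s\<^sub>i s\<^sub>i\<^sub>+\<^sub>1\<close>. The subring generated by \<open>t\<close> and the
  products \<open>s\<^sub>i s\<^sub>j\<close> is formally real with \<open>t\<close> infinitely large, whereas \<open>s\<^sub>i\<^sup>2\<close> is negative there;
  so no relation mixes even and odd expressions in the \<open>s\<^sub>i\<close>, the reflection \<open>s \<mapsto> - s\<close> preserves the
  motion, and \<open>(1,1,1,1,1)\<close> lies in the Galois group.

  Conversely, the volume of \<open>(i, i + 2, T, B)\<close> can be computed along both arcs of the equator. An
  automorphism that changes signs at most on the two edges of the short arc, but changes some sign,
  forces \<open>s\<^sub>i = 0\<close>, \<open>s\<^sub>i\<^sub>+\<^sub>1 = 0\<close> or that this volume vanishes identically. All three are impossible, and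
  the only subgroups of \<open>\<int>\<^sub>2\<^sup>5\<close> that remain are the two claimed ones.
\<close>

section \<open>Fraction fields\<close>

text \<open>The obstacle for the reflection is that \<open>M\<close> is only one irreducible
  component, whose mirror image could a priori be another one. The order that separates even from
  odd expressions makes \<open>t\<close> infinitely large, but \<open>t\<close> is bounded on
  \<open>M\<close>, where every square is nonnegative. Hence the order is handled through polynomial
  identities in \<open>t\<close>, evaluated at large numbers that \<open>t\<close> does not attain.
  All relations between the coordinates have one source. Project the vertices along the axis to the
  orthogonal plane and read that plane as the complex plane. Up to factors that depend on the axis
  only, the conjugate of one projection times another one has a dot product as real part and a
  volume over the axis as imaginary part. Multiplying such numbers along consecutive equatorial
  vertices telescopes, up to squared moduli of the vertices in between. Real parts give the
  diagonals, imaginary parts the volume of \<open>(i, i + 2, T, B)\<close>. That this volume does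
  not vanish rests on the squared moduli: as polynomials in \<open>t\<close> they have simple real
  roots, which determine them.\<close>

lemma UN_pairs_eq_const:
  assumes "\<And>a b c d. (a, b) \<in> X \<Longrightarrow> (c, d) \<in> Y \<Longrightarrow> f a b c d = K"
    and "(a0, b0) \<in> X" and "(c0, d0) \<in> Y"
  shows "(\<Union>(a, b)\<in>X. \<Union>(c, d)\<in>Y. f a b c d) = K"
proof
  show "(\<Union>(a, b)\<in>X. \<Union>(c, d)\<in>Y. f a b c d) \<subseteq> K"
    using assms(1) by auto
  show "K \<subseteq> (\<Union>(a, b)\<in>X. \<Union>(c, d)\<in>Y. f a b c d)"
    using assms by (intro SUP_upper2[OF assms(2)]) (simp, intro SUP_upper2[OF assms(3)], simp)
qed

context domain
begin

lemma fraction_rel_equiv: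
  "equiv (carrier R \<times> (carrier R - {\<zero>})) (fraction_rel R)"
proof (rule equivI)
  show "fraction_rel R \<subseteq> (carrier R \<times> (carrier R - {\<zero>})) \<times> (carrier R \<times> (carrier R - {\<zero>}))"
    by (auto simp: fraction_rel_def)
  show "refl_on (carrier R \<times> (carrier R - {\<zero>})) (fraction_rel R)"
    by (auto simp: fraction_rel_def refl_on_def)
  show "sym (fraction_rel R)"
    by (auto simp: fraction_rel_def sym_def)
  show "trans (fraction_rel R)"
  proof (rule transI, clarify)
    fix a b c d e f
    assume 1: "((a, b), (c, d)) \<in> fraction_rel R" and 2: "((c, d), (e, f)) \<in> fraction_rel R"
    then have c: "a \<in> carrier R" "b \<in> carrier R" "c \<in> carrier R" "d \<in> carrier R" "e \<in> carrier R"
      "f \<in> carrier R" "b \<noteq> \<zero>" "d \<noteq> \<zero>" "f \<noteq> \<zero>" and ad: "a \<otimes> d = c \<otimes> b" and cf: "c \<otimes> f = e \<otimes> d"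
      by (auto simp: fraction_rel_def)
    \<comment> \<open>The middle denominator \<open>d\<close> is multiplied in so that it can be
      cancelled, as there are no zero divisors.\<close>
    have "d \<otimes> (a \<otimes> f) = (a \<otimes> d) \<otimes> f" using c by (simp add: m_ac)
    also have "\<dots> = (c \<otimes> f) \<otimes> b" using c by (simp add: ad m_ac)
    also have "\<dots> = d \<otimes> (e \<otimes> b)" using c by (simp add: cf m_ac)
    finally have "a \<otimes> f = e \<otimes> b"
      using c m_lcancel by simp
    then show "((a, b), (e, f)) \<in> fraction_rel R"
      using c by (auto simp: fraction_rel_def)
  qed
qed

lemma mem_fraction:
  assumes "a \<in> carrier R" "b \<in> carrier R - {\<zero>}"
  shows "(c, d) \<in> fraction R a b \<longleftrightarrow>
     c \<in> carrier R \<and> d \<in> carrier R \<and> d \<noteq> \<zero> \<and> a \<otimes> d = c \<otimes> b"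
  using assms by (auto simp: fraction_def fraction_rel_def)

lemma fraction_eq_iff:
  assumes "a \<in> carrier R" "b \<in> carrier R - {\<zero>}" "c \<in> carrier R" "d \<in> carrier R - {\<zero>}"
  shows "fraction R a b = fraction R c d \<longleftrightarrow> a \<otimes> d = c \<otimes> b"
  unfolding fraction_def
  using eq_equiv_class_iff[OF fraction_rel_equiv, of "(a, b)" "(c, d)"] assms
  by (auto simp: fraction_rel_def)

lemma m_closed_nonzero:
  "a \<in> carrier R - {\<zero>} \<Longrightarrow> b \<in> carrier R - {\<zero>} \<Longrightarrow> a \<otimes> b \<in> carrier R - {\<zero>}"
  using integral by auto

text \<open>The operations of \<open>fraction_field\<close> are unions over all representatives.
  Cross multiplication shows that every choice yields the same class, so that the union collapses to
  it.\<close>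

lemma fraction_mult:
  assumes "a \<in> carrier R" "b \<in> carrier R - {\<zero>}" "c \<in> carrier R" "d \<in> carrier R - {\<zero>}"
  shows "fraction R a b \<otimes>\<^bsub>fraction_field R\<^esub> fraction R c d = fraction R (a \<otimes> c) (b \<otimes> d)"
proof -
  have "fraction R (a' \<otimes> c') (b' \<otimes> d') = fraction R (a \<otimes> c) (b \<otimes> d)"
    if "(a', b') \<in> fraction R a b" "(c', d') \<in> fraction R c d" for a' b' c' d'
  proof -
    have c: "a' \<in> carrier R" "b' \<in> carrier R" "b' \<noteq> \<zero>" "c' \<in> carrier R" "d' \<in> carrier R" "d' \<noteq> \<zero>"
      and 1: "a \<otimes> b' = a' \<otimes> b" and 2: "c \<otimes> d' = c' \<otimes> d"
      using that assms by (auto simp: mem_fraction)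
    have "a' \<otimes> c' \<otimes> (b \<otimes> d) = (a' \<otimes> b) \<otimes> (c' \<otimes> d)" using c assms by (simp add: m_ac)
    also have "\<dots> = (a \<otimes> b') \<otimes> (c \<otimes> d')" by (simp add: 1 2)
    also have "\<dots> = a \<otimes> c \<otimes> (b' \<otimes> d')" using c assms by (simp add: m_ac)
    finally show ?thesis
      using c assms m_closed_nonzero by (subst fraction_eq_iff) auto
  qed
  moreover have "(a, b) \<in> fraction R a b" "(c, d) \<in> fraction R c d"
    using assms by (auto simp: mem_fraction)
  ultimately show ?thesis
    unfolding fraction_field_def ring.simps monoid.simps by (intro UN_pairs_eq_const)
qed

lemma fraction_add:
  assumes "a \<in> carrier R" "b \<in> carrier R - {\<zero>}" "c \<in> carrier R" "d \<in> carrier R - {\<zero>}"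
  shows "fraction R a b \<oplus>\<^bsub>fraction_field R\<^esub> fraction R c d =
    fraction R (a \<otimes> d \<oplus> c \<otimes> b) (b \<otimes> d)"
proof -
  have "fraction R (a' \<otimes> d' \<oplus> c' \<otimes> b') (b' \<otimes> d') = fraction R (a \<otimes> d \<oplus> c \<otimes> b) (b \<otimes> d)"
    if "(a', b') \<in> fraction R a b" "(c', d') \<in> fraction R c d" for a' b' c' d'
  proof -
    have c: "a' \<in> carrier R" "b' \<in> carrier R" "b' \<noteq> \<zero>" "c' \<in> carrier R" "d' \<in> carrier R" "d' \<noteq> \<zero>"
      and 1: "a \<otimes> b' = a' \<otimes> b" and 2: "c \<otimes> d' = c' \<otimes> d"
      using that assms by (auto simp: mem_fraction)
    have "(a' \<otimes> d' \<oplus> c' \<otimes> b') \<otimes> (b \<otimes> d) = (a' \<otimes> b) \<otimes> (d' \<otimes> d) \<oplus> (c' \<otimes> d) \<otimes> (b' \<otimes> b)"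
      using c assms by (simp add: m_ac l_distr r_distr)
    also have "\<dots> = (a \<otimes> b') \<otimes> (d' \<otimes> d) \<oplus> (c \<otimes> d') \<otimes> (b' \<otimes> b)" by (simp add: 1 2)
    also have "\<dots> = (a \<otimes> d \<oplus> c \<otimes> b) \<otimes> (b' \<otimes> d')"
      using c assms by (simp add: m_ac l_distr r_distr)
    finally show ?thesis
      using c assms m_closed_nonzero by (subst fraction_eq_iff) auto
  qed
  moreover have "(a, b) \<in> fraction R a b" "(c, d) \<in> fraction R c d"
    using assms by (auto simp: mem_fraction)
  ultimately show ?thesis
    unfolding fraction_field_def ring.simps monoid.simps by (intro UN_pairs_eq_const)
qed

lemma fraction_carrier:
  "a \<in> carrier R \<Longrightarrow> b \<in> carrier R - {\<zero>} \<Longrightarrow> fraction R a b \<in> carrier (fraction_field R)"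
  by (auto simp: fraction_field_def)

lemma fraction_cases:
  assumes "X \<in> carrier (fraction_field R)"
  obtains a b where "X = fraction R a b" "a \<in> carrier R" "b \<in> carrier R - {\<zero>}"
  using assms by (auto simp: fraction_field_def)

lemma fraction_field_one: "\<one>\<^bsub>fraction_field R\<^esub> = fraction R \<one> \<one>"
  and fraction_field_zero: "\<zero>\<^bsub>fraction_field R\<^esub> = fraction R \<zero> \<one>"
  by (auto simp: fraction_field_def)

lemmas fraction_simps = fraction_mult fraction_add fraction_eq_iff fraction_carrier
  fraction_field_one fraction_field_zero

lemma one_nonzero: "\<one> \<in> carrier R - {\<zero>}"
  by simp

lemma fraction_field_is_field: "field (fraction_field R)"
proof (rule cring.cring_fieldI2)
  let ?F = "fraction_field R"
  have nz: "a \<otimes> b \<noteq> \<zero>" if "a \<in> carrier R" "b \<in> carrier R" "a \<noteq> \<zero>" "b \<noteq> \<zero>" for a b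
    using that integral by auto
  show "cring ?F"
  proof (rule cringI)
    show "abelian_group ?F"
    proof (rule abelian_groupI)
      fix X Y assume X: "X \<in> carrier ?F" and Y: "Y \<in> carrier ?F"
      obtain a b where ab: "X = fraction R a b" "a \<in> carrier R" "b \<in> carrier R - {\<zero>}"
        using X by (rule fraction_cases)
      obtain c d where cd: "Y = fraction R c d" "c \<in> carrier R" "d \<in> carrier R - {\<zero>}"
        using Y by (rule fraction_cases)
      show "X \<oplus>\<^bsub>?F\<^esub> Y \<in> carrier ?F"
        using ab(2,3) cd(2,3) nz[of b d] by (simp add: ab(1) cd(1) fraction_simps)
      show "X \<oplus>\<^bsub>?F\<^esub> Y = Y \<oplus>\<^bsub>?F\<^esub> X"
        using ab(2,3) cd(2,3) by (simp add: ab(1) cd(1) fraction_simps m_comm[of b d] a_comm)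
    next
      show "\<zero>\<^bsub>?F\<^esub> \<in> carrier ?F" by (simp add: fraction_simps)
    next
      fix X Y Z assume X: "X \<in> carrier ?F" and Y: "Y \<in> carrier ?F" and Z: "Z \<in> carrier ?F"
      obtain a b where ab: "X = fraction R a b" "a \<in> carrier R" "b \<in> carrier R - {\<zero>}"
        using X by (rule fraction_cases)
      obtain c d where cd: "Y = fraction R c d" "c \<in> carrier R" "d \<in> carrier R - {\<zero>}"
        using Y by (rule fraction_cases)
      obtain e f where ef: "Z = fraction R e f" "e \<in> carrier R" "f \<in> carrier R - {\<zero>}"
        using Z by (rule fraction_cases)
      show "(X \<oplus>\<^bsub>?F\<^esub> Y) \<oplus>\<^bsub>?F\<^esub> Z = X \<oplus>\<^bsub>?F\<^esub> (Y \<oplus>\<^bsub>?F\<^esub> Z)"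
        using ab(2,3) cd(2,3) ef(2,3) nz[of b d] nz[of d f]
        by (simp add: ab(1) cd(1) ef(1) fraction_mult fraction_add m_ac a_ac l_distr r_distr)
    next
      fix X assume X: "X \<in> carrier ?F"
      obtain a b where ab: "X = fraction R a b" "a \<in> carrier R" "b \<in> carrier R - {\<zero>}"
        using X by (rule fraction_cases)
      show "\<zero>\<^bsub>?F\<^esub> \<oplus>\<^bsub>?F\<^esub> X = X"
        using ab(2,3) by (simp add: ab(1) fraction_field_zero fraction_add)
      have "fraction R (\<ominus> a) b \<oplus>\<^bsub>?F\<^esub> X = \<zero>\<^bsub>?F\<^esub>"
        using ab(2,3) nz[of b b]
        by (simp add: ab(1) fraction_field_zero fraction_add fraction_eq_iff l_minus l_neg)
      then show "\<exists>y\<in>carrier ?F. y \<oplus>\<^bsub>?F\<^esub> X = \<zero>\<^bsub>?F\<^esub>"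
        using ab by (meson a_inv_closed fraction_carrier)
    qed
    show "comm_monoid ?F"
    proof (rule comm_monoidI)
      fix X Y assume X: "X \<in> carrier ?F" and Y: "Y \<in> carrier ?F"
      obtain a b where ab: "X = fraction R a b" "a \<in> carrier R" "b \<in> carrier R - {\<zero>}"
        using X by (rule fraction_cases)
      obtain c d where cd: "Y = fraction R c d" "c \<in> carrier R" "d \<in> carrier R - {\<zero>}"
        using Y by (rule fraction_cases)
      show "X \<otimes>\<^bsub>?F\<^esub> Y \<in> carrier ?F"
        using ab(2,3) cd(2,3) nz[of b d] by (simp add: ab(1) cd(1) fraction_simps)
      show "X \<otimes>\<^bsub>?F\<^esub> Y = Y \<otimes>\<^bsub>?F\<^esub> X"
        using ab(2,3) cd(2,3) by (simp add: ab(1) cd(1) fraction_mult m_comm[of b d] m_comm[of a c])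
    next
      show "\<one>\<^bsub>?F\<^esub> \<in> carrier ?F" by (simp add: fraction_simps)
    next
      fix X Y Z assume X: "X \<in> carrier ?F" and Y: "Y \<in> carrier ?F" and Z: "Z \<in> carrier ?F"
      obtain a b where ab: "X = fraction R a b" "a \<in> carrier R" "b \<in> carrier R - {\<zero>}"
        using X by (rule fraction_cases)
      obtain c d where cd: "Y = fraction R c d" "c \<in> carrier R" "d \<in> carrier R - {\<zero>}"
        using Y by (rule fraction_cases)
      obtain e f where ef: "Z = fraction R e f" "e \<in> carrier R" "f \<in> carrier R - {\<zero>}"
        using Z by (rule fraction_cases)
      show "(X \<otimes>\<^bsub>?F\<^esub> Y) \<otimes>\<^bsub>?F\<^esub> Z = X \<otimes>\<^bsub>?F\<^esub> (Y \<otimes>\<^bsub>?F\<^esub> Z)"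
        using ab(2,3) cd(2,3) ef(2,3) nz[of b d] nz[of d f]
        by (simp add: ab(1) cd(1) ef(1) fraction_mult m_assoc)
    next
      fix X assume X: "X \<in> carrier ?F"
      obtain a b where ab: "X = fraction R a b" "a \<in> carrier R" "b \<in> carrier R - {\<zero>}"
        using X by (rule fraction_cases)
      show "\<one>\<^bsub>?F\<^esub> \<otimes>\<^bsub>?F\<^esub> X = X"
        using ab(2,3) by (simp add: ab(1) fraction_field_one fraction_mult)
    qed
    fix X Y Z assume X: "X \<in> carrier ?F" and Y: "Y \<in> carrier ?F" and Z: "Z \<in> carrier ?F"
    obtain a b where ab: "X = fraction R a b" "a \<in> carrier R" "b \<in> carrier R - {\<zero>}"
      using X by (rule fraction_cases)
    obtain c d where cd: "Y = fraction R c d" "c \<in> carrier R" "d \<in> carrier R - {\<zero>}"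
      using Y by (rule fraction_cases)
    obtain e f where ef: "Z = fraction R e f" "e \<in> carrier R" "f \<in> carrier R - {\<zero>}"
      using Z by (rule fraction_cases)
    show "(X \<oplus>\<^bsub>?F\<^esub> Y) \<otimes>\<^bsub>?F\<^esub> Z = X \<otimes>\<^bsub>?F\<^esub> Z \<oplus>\<^bsub>?F\<^esub> Y \<otimes>\<^bsub>?F\<^esub> Z"
      using ab(2,3) cd(2,3) ef(2,3) nz[of b d] nz[of b f] nz[of d f] nz[of f "b \<otimes> d"]
        nz[of d "b \<otimes> f"] nz[of f "d \<otimes> (b \<otimes> f)"] nz[of f "b \<otimes> (d \<otimes> f)"]
        nz[of "b \<otimes> d" f] nz[of "b \<otimes> f" "d \<otimes> f"]
      by (simp add: ab(1) cd(1) ef(1) fraction_mult fraction_add fraction_eq_iff)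
        (simp add: m_ac a_ac l_distr r_distr)
  qed
  show "\<zero>\<^bsub>?F\<^esub> \<noteq> \<one>\<^bsub>?F\<^esub>" by (simp add: fraction_simps)
  fix X assume X: "X \<in> carrier ?F" "X \<noteq> \<zero>\<^bsub>?F\<^esub>"
  obtain a b where ab: "X = fraction R a b" "a \<in> carrier R" "b \<in> carrier R - {\<zero>}"
    using X(1) by (rule fraction_cases)
  have "a \<noteq> \<zero>" using X ab by (auto simp: fraction_field_zero fraction_eq_iff)
  then have "X \<otimes>\<^bsub>?F\<^esub> fraction R b a = \<one>\<^bsub>?F\<^esub>"
    using ab(2,3) nz[of a b] nz[of b a]
    by (simp add: ab(1) fraction_field_one fraction_mult fraction_eq_iff m_comm[of a b])
  then show "\<exists>Y\<in>carrier ?F. X \<otimes>\<^bsub>?F\<^esub> Y = \<one>\<^bsub>?F\<^esub>"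
    using ab \<open>a \<noteq> \<zero>\<close> by (intro bexI[of _ "fraction R b a"]) (auto simp: fraction_carrier)
qed

section \<open>Extending ring automorphisms to the fraction field\<close>

lemma map_prod_fraction:
  assumes \<theta>: "\<theta> \<in> ring_iso R R" and "a \<in> carrier R" "b \<in> carrier R - {\<zero>}"
  shows "map_prod \<theta> \<theta> ` fraction R a b = fraction R (\<theta> a) (\<theta> b)"
proof -
  interpret h: ring_hom_ring R R \<theta>
    using \<theta> by (simp add: ring_hom_ring_def ring_hom_ring_axioms_def ring_axioms ring_iso_def)
  have bij: "bij_betw \<theta> (carrier R) (carrier R)" using \<theta> by (simp add: ring_iso_def)
  then have inj: "inj_on \<theta> (carrier R)" and surj: "\<theta> ` carrier R = carrier R"
    by (auto simp: bij_betw_def)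
  have z: "\<theta> x = \<zero> \<longleftrightarrow> x = \<zero>" if "x \<in> carrier R" for x
    using inj_onD[OF inj, of x \<zero>] that by auto
  have \<theta>b: "\<theta> b \<in> carrier R - {\<zero>}" using z assms by auto
  show ?thesis
  proof (intro Set.set_eqI iffI)
    fix p assume "p \<in> map_prod \<theta> \<theta> ` fraction R a b"
    then obtain c d where p: "p = (\<theta> c, \<theta> d)" and cd: "(c, d) \<in> fraction R a b" by auto
    then have "c \<in> carrier R" "d \<in> carrier R" "d \<noteq> \<zero>" "a \<otimes> d = c \<otimes> b"
      using assms mem_fraction by auto
    moreover from this have "\<theta> a \<otimes> \<theta> d = \<theta> c \<otimes> \<theta> b"
      using assms h.hom_mult by (metis DiffD1)
    ultimately show "p \<in> fraction R (\<theta> a) (\<theta> b)"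
      unfolding p using assms \<theta>b z by (subst mem_fraction) auto
  next
    fix p assume "p \<in> fraction R (\<theta> a) (\<theta> b)"
    then obtain c' d' where p: "p = (c', d')" "c' \<in> carrier R" "d' \<in> carrier R" "d' \<noteq> \<zero>"
      "\<theta> a \<otimes> d' = c' \<otimes> \<theta> b"
      using assms \<theta>b mem_fraction by (metis h.hom_closed prod.exhaust)
    \<comment> \<open>Surjectivity of \<open>\<theta>\<close> makes the direct image of a class a
      whole class and not just a part of one.\<close>
    obtain c d where cd: "c \<in> carrier R" "d \<in> carrier R" "c' = \<theta> c" "d' = \<theta> d"
      using p surj by (metis imageE)
    have "\<theta> (a \<otimes> d) = \<theta> (c \<otimes> b)"
      using p cd assms by simp
    then have "a \<otimes> d = c \<otimes> b"
      using inj_onD[OF inj, of "a \<otimes> d" "c \<otimes> b"] cd assms by simp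
    then have "(c, d) \<in> fraction R a b"
      using cd p(4) z[of d] assms by (simp add: mem_fraction)
    then show "p \<in> map_prod \<theta> \<theta> ` fraction R a b"
      using p cd by (metis image_eqI map_prod_simp)
  qed
qed

lemma fraction_field_map_iso:
  assumes \<theta>: "\<theta> \<in> ring_iso R R"
  shows "(\<lambda>X\<in>carrier (fraction_field R). map_prod \<theta> \<theta> ` X) \<in>
    ring_iso (fraction_field R) (fraction_field R)"
proof -
  let ?F = "fraction_field R"
  interpret h: ring_hom_ring R R \<theta>
    using \<theta> by (simp add: ring_hom_ring_def ring_hom_ring_axioms_def ring_axioms ring_iso_def)
  have bij: "bij_betw \<theta> (carrier R) (carrier R)" using \<theta> by (simp add: ring_iso_def)
  then have inj: "inj_on \<theta> (carrier R)" and surj: "\<theta> ` carrier R = carrier R"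
    by (auto simp: bij_betw_def)
  have nz: "\<theta> x \<in> carrier R - {\<zero>}" if "x \<in> carrier R - {\<zero>}" for x
    using inj_onD[OF inj, of x \<zero>] that by auto
  interpret F: field ?F by (rule fraction_field_is_field)
  show ?thesis
  proof (rule ring_iso_memI)
    fix X Y assume X: "X \<in> carrier ?F" and Y: "Y \<in> carrier ?F"
    obtain a b where ab: "X = fraction R a b" "a \<in> carrier R" "b \<in> carrier R - {\<zero>}"
      using X by (rule fraction_cases)
    obtain c d where cd: "Y = fraction R c d" "c \<in> carrier R" "d \<in> carrier R - {\<zero>}"
      using Y by (rule fraction_cases)
    note bd = m_closed_nonzero[OF ab(3) cd(3)]
    show "(\<lambda>X\<in>carrier ?F. map_prod \<theta> \<theta> ` X) X \<in> carrier ?F"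
      using X ab nz[of b] by (simp add: map_prod_fraction[OF \<theta>] fraction_carrier)
    show "(\<lambda>X\<in>carrier ?F. map_prod \<theta> \<theta> ` X) (X \<otimes>\<^bsub>?F\<^esub> Y) =
      (\<lambda>X\<in>carrier ?F. map_prod \<theta> \<theta> ` X) X \<otimes>\<^bsub>?F\<^esub> (\<lambda>X\<in>carrier ?F. map_prod \<theta> \<theta> ` X) Y"
      using X Y F.m_closed[OF X Y] nz ab(2,3) cd(2,3) bd
      by (simp add: ab(1) cd(1) fraction_mult map_prod_fraction[OF \<theta>] del: F.m_closed)
    show "(\<lambda>X\<in>carrier ?F. map_prod \<theta> \<theta> ` X) (X \<oplus>\<^bsub>?F\<^esub> Y) =
      (\<lambda>X\<in>carrier ?F. map_prod \<theta> \<theta> ` X) X \<oplus>\<^bsub>?F\<^esub> (\<lambda>X\<in>carrier ?F. map_prod \<theta> \<theta> ` X) Y"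
      using X Y F.a_closed[OF X Y] nz ab(2,3) cd(2,3) bd
      by (simp add: ab(1) cd(1) fraction_add map_prod_fraction[OF \<theta>] del: F.a_closed)
  next
    show "(\<lambda>X\<in>carrier ?F. map_prod \<theta> \<theta> ` X) \<one>\<^bsub>?F\<^esub> = \<one>\<^bsub>?F\<^esub>"
      using F.one_closed by (simp add: fraction_field_one map_prod_fraction[OF \<theta>] del: F.one_closed)
  next
    have "inj_on (\<lambda>X\<in>carrier ?F. map_prod \<theta> \<theta> ` X) (carrier ?F)"
    proof (rule inj_onI)
      fix X Y assume X: "X \<in> carrier ?F" and Y: "Y \<in> carrier ?F"
        and eq: "(\<lambda>X\<in>carrier ?F. map_prod \<theta> \<theta> ` X) X = (\<lambda>X\<in>carrier ?F. map_prod \<theta> \<theta> ` X) Y"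
      obtain a b where ab: "X = fraction R a b" "a \<in> carrier R" "b \<in> carrier R - {\<zero>}"
        using X by (rule fraction_cases)
      obtain c d where cd: "Y = fraction R c d" "c \<in> carrier R" "d \<in> carrier R - {\<zero>}"
        using Y by (rule fraction_cases)
      have "fraction R (\<theta> a) (\<theta> b) = fraction R (\<theta> c) (\<theta> d)"
        using eq X Y ab cd by (simp add: map_prod_fraction[OF \<theta>])
      then have "\<theta> (a \<otimes> d) = \<theta> (c \<otimes> b)"
        using nz[OF ab(3)] nz[OF cd(3)] ab cd by (simp add: fraction_eq_iff)
      then have "a \<otimes> d = c \<otimes> b" using inj_onD[OF inj, of "a \<otimes> d" "c \<otimes> b"] ab(2,3) cd(2,3) by simp
      then show "X = Y" using ab cd by (simp add: fraction_eq_iff)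
    qed
    moreover have "(\<lambda>X\<in>carrier ?F. map_prod \<theta> \<theta> ` X) ` carrier ?F = carrier ?F"
    proof (intro Set.set_eqI iffI)
      fix Y assume "Y \<in> (\<lambda>X\<in>carrier ?F. map_prod \<theta> \<theta> ` X) ` carrier ?F"
      then obtain X where X: "X \<in> carrier ?F" "Y = map_prod \<theta> \<theta> ` X" by auto
      obtain a b where ab: "X = fraction R a b" "a \<in> carrier R" "b \<in> carrier R - {\<zero>}"
        using X(1) by (rule fraction_cases)
      then show "Y \<in> carrier ?F"
        using X nz[of b] by (simp add: map_prod_fraction[OF \<theta>] fraction_carrier)
    next
      fix Y assume Y: "Y \<in> carrier ?F"
      obtain c d where cd: "Y = fraction R c d" "c \<in> carrier R" "d \<in> carrier R - {\<zero>}"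
        using Y by (rule fraction_cases)
      have "c \<in> \<theta> ` carrier R" "d \<in> \<theta> ` carrier R"
        using cd(2,3) surj by auto
      then obtain a b where ab: "a \<in> carrier R" "b \<in> carrier R" "c = \<theta> a" "d = \<theta> b"
        by blast
      have "b \<noteq> \<zero>" using ab cd(3) by auto
      then have "Y = (\<lambda>X\<in>carrier ?F. map_prod \<theta> \<theta> ` X) (fraction R a b)"
        using ab cd(1) by (simp add: map_prod_fraction[OF \<theta>] fraction_carrier)
      then show "Y \<in> (\<lambda>X\<in>carrier ?F. map_prod \<theta> \<theta> ` X) ` carrier ?F"
        using ab(1,2) \<open>b \<noteq> \<zero>\<close> fraction_carrier[of a b] by auto
    qed
    ultimately show "bij_betw (\<lambda>X\<in>carrier ?F. map_prod \<theta> \<theta> ` X) (carrier ?F) (carrier ?F)"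
      by (simp add: bij_betw_def)
  qed
qed

end


lemma (in field) generate_field_fixed:
  assumes \<phi>: "\<phi> \<in> ring_iso R R" and H: "H \<subseteq> carrier R" and fixed: "\<And>x. x \<in> H \<Longrightarrow> \<phi> x = x"
    and x: "x \<in> generate_field R H"
  shows "\<phi> x = x"
proof -
  interpret h: ring_hom_ring R R \<phi>
    using \<phi> by (simp add: ring_hom_ring_def ring_hom_ring_axioms_def ring_axioms ring_iso_def)
  note G = generate_field_in_carrier[OF H]
  show ?thesis
    using x
  proof induction
    case (m_inv h)
    have h: "h \<in> carrier R" "h \<in> Units R" using m_inv G field_Units by auto
    have i: "inv h \<in> carrier R" using h by auto
    \<comment> \<open>As \<open>h\<close> is fixed, \<open>\<phi> (inv h)\<close> is again an
      inverse of \<open>h\<close>, and inverses are unique.\<close>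
    have "h \<otimes> \<phi> (inv h) = \<phi> (h \<otimes> inv h)" using h i m_inv(3) by (metis h.hom_mult)
    also have "\<dots> = \<one>" using h by (simp add: Units_r_inv)
    finally show ?case using h i comm_inv_char[of h "\<phi> (inv h)"] by simp
  next
    case (incl h) then show ?case by (rule fixed)
  next
    case (a_inv h) then show ?case using G[of h] by simp
  next
    case (eng_add h1 h2) then show ?case using G[of h1] G[of h2] by simp
  next
    case (eng_mult h1 h2) then show ?case using G[of h1] G[of h2] by simp
  qed simp
qed


section \<open>Dot products and volumes relative to an axis\<close>

definition vol :: "real^3 \<Rightarrow> real^3 \<Rightarrow> real^3 \<Rightarrow> real" where
  "vol u x y = det (vector [x, y, u] :: real^3^3)"

text \<open>This is \<open>u \<bullet> u\<close> times the inner product of the projections of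
  \<open>x\<close> and \<open>y\<close> to the plane orthogonal to \<open>u\<close>. In complex
  notation for that plane, suitably oriented, \<open>dot u x y\<close> and
  \<open>norm u * vol u x y\<close> are the real and the imaginary part of
  \<open>u \<bullet> u\<close> times the conjugate of the first projection times the second.\<close>

definition dot :: "real^3 \<Rightarrow> real^3 \<Rightarrow> real^3 \<Rightarrow> real" where
  "dot u x y = (u \<bullet> u) * (x \<bullet> y) - (x \<bullet> u) * (y \<bullet> u)"

lemma dot_commute: "dot u x y = dot u y x"
  by (simp add: dot_def inner_commute)

lemma vol_commute: "vol u x y = - vol u y x"
  by (simp add: vol_def det_3 algebra_simps)

text \<open>The product of two determinants is the determinant of the mixed inner products of their
  rows; the right-hand side is its expansion.\<close>

lemma vol_mult_vol:
  "vol u x y * vol u y z = (x \<bullet> y) * (y \<bullet> z) * (u \<bullet> u) + (x \<bullet> z) * (y \<bullet> u) * (y \<bullet> u)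
     + (x \<bullet> u) * (y \<bullet> y) * (z \<bullet> u) - (x \<bullet> u) * (y \<bullet> z) * (y \<bullet> u)
     - (x \<bullet> y) * (y \<bullet> u) * (z \<bullet> u) - (x \<bullet> z) * (y \<bullet> y) * (u \<bullet> u)"
  by (simp add: vol_def det_3 inner_vec_def sum_3 algebra_simps)

lemma gram_vol:
  "(vol u x y)\<^sup>2 = (u \<bullet> u) * (x \<bullet> x) * (y \<bullet> y) + 2 * (x \<bullet> y) * (x \<bullet> u) * (y \<bullet> u)
     - (u \<bullet> u) * (x \<bullet> y)\<^sup>2 - (x \<bullet> x) * (y \<bullet> u)\<^sup>2 - (y \<bullet> y) * (x \<bullet> u)\<^sup>2"
  using vol_mult_vol[of u x y x] vol_commute[of u y x]
  by (simp add: power2_eq_square inner_commute algebra_simps)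

text \<open>Real part of the product of the complex numbers attached to \<open>(x, y)\<close> and
  \<open>(y, z)\<close>: the projection of \<open>y\<close> enters only through its squared modulus,
  which is the factor \<open>dot u y y\<close>. The imaginary part of the same product is
  \<open>dot_vol\<close>.\<close>

lemma dot_dot:
  "dot u x y * dot u y z - (u \<bullet> u) * (vol u x y * vol u y z) = dot u y y * dot u x z"
  unfolding vol_mult_vol by (simp add: dot_def inner_commute algebra_simps)

lemma dot_vol:
  "dot u x y * vol u y z + vol u x y * dot u y z = dot u y y * vol u x z"
  by (simp add: vol_def dot_def det_3 inner_vec_def sum_3 algebra_simps)

text \<open>Three vectors in a plane have a vanishing Gram determinant. Here it arises, multiplied
  by \<open>dot u y y\<close>, from squaring the relation \<open>dot_dot\<close> and expressing each
  squared volume by dot products.\<close>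

lemma dot_gram:
  assumes "dot u y y \<noteq> 0"
  shows "dot u x x * dot u y y * dot u z z + 2 * dot u x y * dot u y z * dot u x z =
   dot u x x * (dot u y z)\<^sup>2 + dot u y y * (dot u x z)\<^sup>2 + dot u z z * (dot u x y)\<^sup>2"
proof -
  let ?d = "dot u y y" and ?n = "dot u x z" and ?p = "dot u x y" and ?r = "dot u y z"
  let ?X = "(u \<bullet> u) * (vol u x y)\<^sup>2" and ?Z = "(u \<bullet> u) * (vol u y z)\<^sup>2"
  have X: "?X = ?d * dot u x x - ?p\<^sup>2"
    using dot_dot[of u x y x] vol_commute[of u y x] dot_commute[of u y x]
    by (simp add: power2_eq_square algebra_simps)
  have Z: "?Z = ?d * dot u z z - ?r\<^sup>2"
    using dot_dot[of u z y z] vol_commute[of u z y] dot_commute[of u z y]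
    by (simp add: power2_eq_square algebra_simps)
  have "?p * ?r - ?d * ?n = (u \<bullet> u) * (vol u x y * vol u y z)"
    using dot_dot[of u x y z] by simp
  then have "(?p * ?r - ?d * ?n)\<^sup>2 = ?X * ?Z"
    by (simp add: power2_eq_square)
  then have "?d * (dot u x x * ?d * dot u z z + 2 * ?p * ?r * ?n) =
    ?d * (dot u x x * ?r\<^sup>2 + ?d * ?n\<^sup>2 + dot u z z * ?p\<^sup>2)"
    unfolding X Z by (simp add: power2_eq_square algebra_simps)
  then show ?thesis using assms by simp
qed

section \<open>The integers modulo 5\<close>

lemma exhaust_5: fixes x :: 5 shows "x = 1 \<or> x = 2 \<or> x = 3 \<or> x = 4 \<or> x = 5"
proof (induct x)
  case (of_int z)
  then have "z = 0 \<or> z = 1 \<or> z = 2 \<or> z = 3 \<or> z = 4" by auto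
  then show ?case by auto
qed

lemma forall_5: "(\<forall>i::5. P i) \<longleftrightarrow> P 1 \<and> P 2 \<and> P 3 \<and> P 4 \<and> P 5"
  by (metis exhaust_5)

lemma add_mod5: "i + 1 + 1 = i + (2::5)" "i + 2 + 1 = i + (3::5)" "i + 3 + 1 = i + (4::5)" "i + 4 + 1 = (i::5)"
  "i + 2 + 2 = i + (4::5)" "i + 3 + 2 = (i::5)"
  by (simp_all add: add.assoc)

lemma numeral_mod5: "6 = (1::5)" "7 = (2::5)" "8 = (3::5)" "9 = (4::5)"
  "- 1 = (4::5)" "- 2 = (3::5)" "- 3 = (2::5)" "- 4 = (1::5)"
  by simp_all

text \<open>The indices \<open>5\<close> and \<open>0\<close> coincide in this type, so the fifth
  entry is given in both forms.\<close>

lemma vector_5 [simp]: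
  "(vector [x1, x2, x3, x4, x5] :: 'a::zero^5) $ 1 = x1"
  "(vector [x1, x2, x3, x4, x5] :: 'a::zero^5) $ 2 = x2"
  "(vector [x1, x2, x3, x4, x5] :: 'a::zero^5) $ 3 = x3"
  "(vector [x1, x2, x3, x4, x5] :: 'a::zero^5) $ 4 = x4"
  "(vector [x1, x2, x3, x4, x5] :: 'a::zero^5) $ 5 = x5"
  "(vector [x1, x2, x3, x4, x5] :: 'a::zero^5) $ 0 = x5"
  unfolding vector_def by simp_all

lemma mod5_offset: "j = i \<or> j = i + 1 \<or> j = i + 2 \<or> j = i + 3 \<or> j = i + (4::5)"
proof -
  have five: "(5::5) = 0" by simp
  have "j - i = 0 \<or> j - i = 1 \<or> j - i = 2 \<or> j - i = 3 \<or> j - i = 4"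
    using exhaust_5[of "j - i"] five by auto
  then show ?thesis by (auto simp: algebra_simps)
qed

lemma vector_ones: "(vector [c, c, c, c, c] :: 'a::zero^5) $ i = c"
  using exhaust_5[of i] by (elim disjE) simp_all

section \<open>The combinatorics of the sign tuples\<close>

lemma exists_bits5:
  fixes h :: "bit^5"
  obtains b1 b2 b3 b4 b5 where "h = vector [b1, b2, b3, b4, b5]"
proof
  show "h = vector [h$1, h$2, h$3, h$4, h$5]"
    by (simp add: vec_eq_iff forall_5 del: vector_5(6)) 
qed

lemma bit_vec_add_self: "g + g = (0 :: bit^'n)"
  by (simp add: vec_eq_iff)

lemma bit_vec_eq_of_add: "x + y = 0 \<Longrightarrow> x = (y :: bit^'n)"
  by (metis add.assoc add.left_neutral add.right_neutral bit_vec_add_self)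

lemma edge_perm_rotation: "edge_perm (\<lambda>i. a + i) i = a + i"
  unfolding edge_perm_def
proof (rule the_equality)
  show "{a + i, a + i + 1} = {a + i, a + (i + 1)}" by (simp add: add.assoc)
next
  fix j assume "{j, j + 1} = {a + i, a + (i + 1)}"
  then have "j = a + i \<or> j = a + i + 1 \<and> j + 1 = a + i"
    by (auto simp: doubleton_eq_iff add.assoc)
  then show "j = a + i"
  proof
    \<comment> \<open>Matching the edge with its ends exchanged would force \<open>2 = 0\<close>
      modulo 5.\<close>
    assume "j = a + i + 1 \<and> j + 1 = a + i"
    then have "a + i + 2 = a + i" using add_mod5(1)[of "a + i"] by metis
    then show ?thesis by simp
  qed
qed

lemma rotation_in_dihedral: "(\<lambda>i. a + i) \<in> dihedral"
  unfolding dihedral_def by (intro UnI1 rangeI)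

lemma relabel_rotation: "relabel (\<lambda>i. a + i) b $ i = b $ (a + i)"
  by (simp add: relabel_def edge_perm_rotation)

lemma bit_vec_group_closure:
  fixes G :: "(bit^5) set"
  assumes zero: "0 \<in> G" and add: "\<And>g h. g \<in> G \<Longrightarrow> h \<in> G \<Longrightarrow> g + h \<in> G" and "S \<subseteq> G"
  shows "group_closure S \<subseteq> G"
proof
  fix x assume "x \<in> group_closure S"
  then show "x \<in> G"
  proof induction
    case (base s) then show ?case using assms by auto
  next
    case (diff s t)
    have "- t = t" by (simp add: vec_eq_iff)
    then have "s - t = s + t" by (metis diff_conv_add_uminus)
    then show ?case using diff add by metis
  qed
qed

text \<open>The assumption forbids nonzero tuples supported on two adjacent edges. Writing it out
  for all five windows makes the classification a finite check of bits.\<close>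

lemma three_consecutive_bits:
  fixes g :: "bit^5"
  assumes adj: "\<forall>g\<in>G. \<forall>i. g $ (i + 2) = 0 \<longrightarrow> g $ (i + 3) = 0 \<longrightarrow> g $ (i + 4) = 0 \<longrightarrow> g = 0"
    and "g \<in> G" and "g \<noteq> 0"
  shows "g $ 3 = 1 \<or> g $ 4 = 1 \<or> g $ 5 = 1" "g $ 4 = 1 \<or> g $ 5 = 1 \<or> g $ 1 = 1"
    "g $ 5 = 1 \<or> g $ 1 = 1 \<or> g $ 2 = 1" "g $ 1 = 1 \<or> g $ 2 = 1 \<or> g $ 3 = 1"
    "g $ 2 = 1 \<or> g $ 3 = 1 \<or> g $ 4 = 1"
proof -
  have w: "g $ (i + 2) = 1 \<or> g $ (i + 3) = 1 \<or> g $ (i + 4) = 1" for i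
  proof (rule ccontr)
    assume "\<not> ?thesis"
    then have "g $ (i + 2) = 0" "g $ (i + 3) = 0" "g $ (i + 4) = 0" by simp_all
    then show False using assms by blast
  qed
  show "g $ 3 = 1 \<or> g $ 4 = 1 \<or> g $ 5 = 1" "g $ 4 = 1 \<or> g $ 5 = 1 \<or> g $ 1 = 1"
    "g $ 5 = 1 \<or> g $ 1 = 1 \<or> g $ 2 = 1" "g $ 1 = 1 \<or> g $ 2 = 1 \<or> g $ 3 = 1"
    "g $ 2 = 1 \<or> g $ 3 = 1 \<or> g $ 4 = 1"
    using w[of 1] w[of 2] w[of 3] w[of 4] w[of 5] by (simp_all add: numeral_mod5)
qed

text \<open>A second tuple supported on two non-adjacent edges, added to \<open>(1,0,1,0,0)\<close>,
  leaves modulo the all-ones tuple a single edge or two adjacent edges, which \<open>adj\<close>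
  excludes.\<close>

lemma sign_group_rotated:
  fixes G :: "(bit^5) set"
  assumes one: "vector [1, 1, 1, 1, 1] \<in> G"
    and add: "\<And>g h. g \<in> G \<Longrightarrow> h \<in> G \<Longrightarrow> g + h \<in> G"
    and adj: "\<And>g i. g \<in> G \<Longrightarrow> g $ (i + 2) = 0 \<Longrightarrow> g $ (i + 3) = 0 \<Longrightarrow> g $ (i + 4) = 0 \<Longrightarrow> g = 0"
    and g: "vector [1, 0, 1, 0, 0] \<in> G"
  shows "G = group_closure {vector [1, 1, 1, 1, 1], vector [1, 0, 1, 0, 0]}"
proof
  let ?S = "{vector [1, 1, 1, 1, 1], vector [1, 0, 1, 0, 0]} :: (bit^5) set"
  have zero: "0 \<in> G" using add[OF g g] by (simp only: bit_vec_add_self)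
  show "group_closure ?S \<subseteq> G"
    by (rule bit_vec_group_closure[OF zero]) (use one g add in auto)
  show "G \<subseteq> group_closure ?S"
  proof
    fix h assume h: "h \<in> G"
    define u v where "u = (vector [1, 1, 1, 1, 1] :: bit^5)" and "v = (vector [1, 0, 1, 0, 0] :: bit^5)"
    have uv: "u \<in> G" "v \<in> G" using one g by (auto simp: u_def v_def)
    obtain b1 b2 b3 b4 b5 where b: "h = vector [b1, b2, b3, b4, b5]" by (rule exists_bits5)
    have S: "u \<in> group_closure ?S" "v \<in> group_closure ?S"
      unfolding u_def v_def by (auto intro: group_closure.base)
    have "h = 0 \<or> h + u = 0 \<or> h + v = 0 \<or> h + (u + v) = 0"
    proof (rule ccontr)
      assume "\<not> ?thesis"
      then have n: "h \<noteq> 0" "h + u \<noteq> 0" "h + v \<noteq> 0" "h + (u + v) \<noteq> 0" by auto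
      have adj': "\<forall>g\<in>G. \<forall>i. g $ (i + 2) = 0 \<longrightarrow> g $ (i + 3) = 0 \<longrightarrow> g $ (i + 4) = 0 \<longrightarrow> g = 0"
        using adj by blast
      note w = three_consecutive_bits[OF adj']
      show False
        using w[OF h n(1)] w[OF add[OF h uv(1)] n(2)] w[OF add[OF h uv(2)] n(3)]
          w[OF add[OF h add[OF uv]] n(4)]
        by (cases b1; cases b2; cases b3; cases b4; cases b5; simp add: b u_def v_def)
    qed
    then have "h = 0 \<or> h = u \<or> h = v \<or> h = u + v"
      using bit_vec_eq_of_add[of h u] bit_vec_eq_of_add[of h v] bit_vec_eq_of_add[of h "u + v"]
      by auto
    then show "h \<in> group_closure ?S" using S group_closure_add[OF S] by auto
  qed
qed

text \<open>Modulo the all-ones tuple every tuple has weight at most two, and \<open>adj\<close> leaves only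
  tuples supported on two non-adjacent edges.\<close>

lemma sign_group_classification:
  fixes G :: "(bit^5) set"
  assumes one: "vector [1, 1, 1, 1, 1] \<in> G"
    and add: "\<And>g h. g \<in> G \<Longrightarrow> h \<in> G \<Longrightarrow> g + h \<in> G"
    and adj: "\<And>g i. g \<in> G \<Longrightarrow> g $ (i + 2) = 0 \<Longrightarrow> g $ (i + 3) = 0 \<Longrightarrow> g $ (i + 4) = 0 \<Longrightarrow> g = 0"
  shows "\<exists>\<sigma>\<in>dihedral.
    relabel \<sigma> ` G = group_closure {vector [1, 1, 1, 1, 1]} \<or>
    relabel \<sigma> ` G = group_closure {vector [1, 1, 1, 1, 1], vector [1, 0, 1, 0, 0]}"
proof -
  define u where "u = (vector [1, 1, 1, 1, 1] :: bit^5)"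
  have zero: "0 \<in> G" using add[OF one one] by (simp only: bit_vec_add_self)
  show ?thesis
  proof (cases "G \<subseteq> {0, u}")
    case True
    have id: "relabel (\<lambda>i. 0 + i) = (\<lambda>b. b)"
      by (rule ext) (simp only: vec_eq_iff relabel_rotation, simp)
    have "group_closure {u} \<subseteq> G"
      by (rule bit_vec_group_closure[OF zero]) (use one add in \<open>auto simp: u_def\<close>)
    moreover have "G \<subseteq> group_closure {u}"
      using True by (auto intro: group_closure.base)
    ultimately have "G = group_closure {u}" by blast
    then have "relabel (\<lambda>i. 0 + i) ` G = group_closure {vector [1, 1, 1, 1, 1]}"
      unfolding id u_def by simp
    then show ?thesis using rotation_in_dihedral by blast
  next
    case False
    then obtain g where g: "g \<in> G" "g \<noteq> 0" "g \<noteq> u" by auto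
    have gu: "g + u \<in> G" using g one add by (simp add: u_def)
    have gu0: "g + u \<noteq> 0" using g bit_vec_eq_of_add by blast
    \<comment> \<open>Relabeling by \<open>\<lambda>i. a + i\<close> undoes this shift by
      \<open>- a\<close>. Rotations suffice because the five pairs of non-adjacent edges form a
      single orbit.\<close>
    obtain a where a: "(\<chi> i. vector [1, 0, 1, 0, 0] $ (i - a)) \<in> G"
    proof -
      obtain b1 b2 b3 b4 b5 where b: "g = vector [b1, b2, b3, b4, b5]" by (rule exists_bits5)
      have adj': "\<forall>g\<in>G. \<forall>i. g $ (i + 2) = 0 \<longrightarrow> g $ (i + 3) = 0 \<longrightarrow> g $ (i + 4) = 0 \<longrightarrow> g = 0"
        using adj by blast
      note w = three_consecutive_bits[OF adj']
      have "\<exists>a. (\<chi> i. vector [1, 0, 1, 0, 0] $ (i - a)) = g \<or> (\<chi> i. vector [1, 0, 1, 0, 0] $ (i - a)) = g + u"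
      proof -
        have r: "(\<chi> i. (vector [1, 0, 1, 0, 0] :: bit^5) $ (i - 5)) = vector [1, 0, 1, 0, 0]"
          "(\<chi> i. (vector [1, 0, 1, 0, 0] :: bit^5) $ (i - 1)) = vector [0, 1, 0, 1, 0]"
          "(\<chi> i. (vector [1, 0, 1, 0, 0] :: bit^5) $ (i - 2)) = vector [0, 0, 1, 0, 1]"
          "(\<chi> i. (vector [1, 0, 1, 0, 0] :: bit^5) $ (i - 3)) = vector [1, 0, 0, 1, 0]"
          "(\<chi> i. (vector [1, 0, 1, 0, 0] :: bit^5) $ (i - 4)) = vector [0, 1, 0, 0, 1]"
          by (simp_all add: vec_eq_iff forall_5 numeral_mod5)
        have "g \<in> {vector [1, 0, 1, 0, 0], vector [0, 1, 0, 1, 0], vector [0, 0, 1, 0, 1],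
            vector [1, 0, 0, 1, 0], vector [0, 1, 0, 0, 1]} \<or>
          g + u \<in> {vector [1, 0, 1, 0, 0], vector [0, 1, 0, 1, 0], vector [0, 0, 1, 0, 1],
            vector [1, 0, 0, 1, 0], vector [0, 1, 0, 0, 1]}"
          using w[OF g(1,2)] w[OF gu gu0]
          by (cases b1; cases b2; cases b3; cases b4; cases b5;
              simp add: b u_def vec_eq_iff forall_5)
        then show ?thesis using r by (metis empty_iff insert_iff)
      qed
      then show ?thesis using that g gu by metis
    qed
    let ?r = "relabel (\<lambda>i. a + i)"
    have "?r ` G = group_closure {vector [1, 1, 1, 1, 1], vector [1, 0, 1, 0, 0]}"
    proof (rule sign_group_rotated)
      have "vector [1, 1, 1, 1, 1] = ?r u"
        by (simp add: vec_eq_iff relabel_rotation u_def vector_ones)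
      then show "vector [1, 1, 1, 1, 1] \<in> ?r ` G" using one by (auto simp: u_def)
      have "vector [1, 0, 1, 0, 0] = ?r (\<chi> i. vector [1, 0, 1, 0, 0] $ (i - a))"
        by (simp add: vec_eq_iff relabel_rotation)
      then show "vector [1, 0, 1, 0, 0] \<in> ?r ` G" using a by blast
    next
      fix x y assume "x \<in> ?r ` G" "y \<in> ?r ` G"
      then obtain g h where "g \<in> G" "h \<in> G" "x = ?r g" "y = ?r h" by auto
      moreover have "?r g + ?r h = ?r (g + h)" by (simp add: vec_eq_iff relabel_rotation)
      ultimately show "x + y \<in> ?r ` G" using add by auto
    next
      fix x i assume "x \<in> ?r ` G" and x: "x $ (i + 2) = 0" "x $ (i + 3) = 0" "x $ (i + 4) = 0"
      then obtain g where g: "g \<in> G" "x = ?r g" by auto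
      have "g = 0"
        using x g adj[of g "a + i"] by (simp add: relabel_rotation add.assoc)
      then show "x = 0" using g by (simp add: vec_eq_iff relabel_rotation)
    qed
    then show ?thesis using rotation_in_dihedral by blast
  qed
qed


section \<open>Irreducible sets and their function fields\<close>

lemma zariski_closed_vanishing:
  "real_polynomial_function f \<Longrightarrow> zariski_closed {x. f x = 0}"
  unfolding zariski_closed_def by (intro exI[of _ "{f}"]) auto

lemma irreducible_vanishing_mult:
  assumes M: "zariski_irreducible M"
    and f: "real_polynomial_function f" and g: "real_polynomial_function g"
    and fg: "\<forall>x\<in>M. f x * g x = 0"
  shows "(\<forall>x\<in>M. f x = 0) \<or> (\<forall>x\<in>M. g x = 0)"
proof -
  have "M \<subseteq> {x. f x = 0} \<union> {x. g x = 0}" using fg by auto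
  then show ?thesis
    using M zariski_closed_vanishing[OF f] zariski_closed_vanishing[OF g]
    unfolding zariski_irreducible_def by blast
qed

lemma irreducible_vanishing_open:
  assumes M: "zariski_irreducible M" and Z: "zariski_closed Z" "\<not> M \<subseteq> Z"
    and f: "real_polynomial_function f" and "\<forall>x\<in>M - Z. f x = 0"
  shows "\<forall>x\<in>M. f x = 0"
proof -
  have "M \<subseteq> Z \<union> {x. f x = 0}" using assms(5) by auto
  then show ?thesis
    using M Z zariski_closed_vanishing[OF f] unfolding zariski_irreducible_def by blast
qed

text \<open>A component of a closed set is the zero set of its vanishing ideal: that zero set
  \<open>N\<close> lies in the same closed sets as \<open>M\<close>, hence is irreducible and
  contained in \<open>K\<close>, and maximality gives \<open>N = M\<close>.\<close>

lemma irreducible_component_vanishing: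
  assumes M: "irreducible_component K M"
    and K: "zariski_closed K"
    and p: "\<And>f. real_polynomial_function f \<Longrightarrow> \<forall>x\<in>M. f x = 0 \<Longrightarrow> f p = 0"
  shows "p \<in> M"
proof -
  define N where "N = {x. \<forall>f. real_polynomial_function f \<longrightarrow> (\<forall>y\<in>M. f y = 0) \<longrightarrow> f x = 0}"
  have closed: "N \<subseteq> C" if "zariski_closed C" "M \<subseteq> C" for C
    using that unfolding N_def zariski_closed_def by blast
  have MN: "M \<subseteq> N" unfolding N_def by auto
  have "M \<subseteq> K" "zariski_irreducible M" using M by (auto simp: irreducible_component_def)
  then have "zariski_irreducible N"
    using MN closed unfolding zariski_irreducible_def by (metis order.trans subset_empty)
  then have "N = M"
    using M MN closed[OF K \<open>M \<subseteq> K\<close>] unfolding irreducible_component_def by blast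
  then show ?thesis using p unfolding N_def by blast
qed

lemma coordinate_ring_simps:
  "x \<in> carrier (coordinate_ring M) \<longleftrightarrow> (\<exists>f. real_polynomial_function f \<and> x = restrict f M)"
  "f \<otimes>\<^bsub>coordinate_ring M\<^esub> g = (\<lambda>x\<in>M. f x * g x)"
  "f \<oplus>\<^bsub>coordinate_ring M\<^esub> g = (\<lambda>x\<in>M. f x + g x)"
  "\<one>\<^bsub>coordinate_ring M\<^esub> = (\<lambda>x\<in>M. 1)"
  "\<zero>\<^bsub>coordinate_ring M\<^esub> = (\<lambda>x\<in>M. 0)"
  by (auto simp: coordinate_ring_def)

lemma restrict_eq_iff: "restrict f M = restrict g M \<longleftrightarrow> (\<forall>x\<in>M. f x = g x)"
  by (auto simp: restrict_def fun_eq_iff)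

lemma coordinate_ring_cring: "cring (coordinate_ring M)"
proof (rule cringI)
  show "abelian_group (coordinate_ring M)"
  proof (rule abelian_groupI)
    fix x assume "x \<in> carrier (coordinate_ring M)"
    then obtain f where f: "real_polynomial_function f" "x = restrict f M"
      by (auto simp: coordinate_ring_simps)
    then have "restrict (\<lambda>x. - f x) M \<oplus>\<^bsub>coordinate_ring M\<^esub> x = \<zero>\<^bsub>coordinate_ring M\<^esub>"
      by (simp add: coordinate_ring_simps cong: restrict_cong)
    moreover have "restrict (\<lambda>x. - f x) M \<in> carrier (coordinate_ring M)"
      using f by (auto simp: coordinate_ring_simps)
    ultimately show "\<exists>y\<in>carrier (coordinate_ring M). y \<oplus>\<^bsub>coordinate_ring M\<^esub> x = \<zero>\<^bsub>coordinate_ring M\<^esub>"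
      by blast
  qed (auto simp: coordinate_ring_simps restrict_eq_iff cong: restrict_cong)
  show "comm_monoid (coordinate_ring M)"
    by (rule comm_monoidI) (auto simp: coordinate_ring_simps restrict_eq_iff cong: restrict_cong)
qed (auto simp: coordinate_ring_simps restrict_eq_iff algebra_simps)

lemma coordinate_ring_domain:
  assumes M: "zariski_irreducible M"
  shows "domain (coordinate_ring M)"
proof -
  interpret cring "coordinate_ring M" by (rule coordinate_ring_cring)
  show ?thesis
  proof
    show "\<one>\<^bsub>coordinate_ring M\<^esub> \<noteq> \<zero>\<^bsub>coordinate_ring M\<^esub>"
      using M by (auto simp: coordinate_ring_simps restrict_eq_iff zariski_irreducible_def)
    fix a b assume ab: "a \<otimes>\<^bsub>coordinate_ring M\<^esub> b = \<zero>\<^bsub>coordinate_ring M\<^esub>"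
      "a \<in> carrier (coordinate_ring M)" "b \<in> carrier (coordinate_ring M)"
    then obtain f g where "real_polynomial_function f" "a = restrict f M"
      "real_polynomial_function g" "b = restrict g M"
      by (auto simp: coordinate_ring_simps)
    then show "a = \<zero>\<^bsub>coordinate_ring M\<^esub> \<or> b = \<zero>\<^bsub>coordinate_ring M\<^esub>"
      using irreducible_vanishing_mult[OF M, of f g] ab(1)
      by (simp add: coordinate_ring_simps restrict_eq_iff)
  qed
qed

lemma coordinate_ring_one_nonzero:
  "zariski_irreducible M \<Longrightarrow> (\<lambda>x\<in>M. 1) \<in> carrier (coordinate_ring M) - {\<zero>\<^bsub>coordinate_ring M\<^esub>}"
  using domain.one_nonzero[OF coordinate_ring_domain, of M] by (simp add: coordinate_ring_simps(4))

lemma coordinate_ring_restrict: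
  "real_polynomial_function f \<Longrightarrow> restrict f M \<in> carrier (coordinate_ring M)"
  by (auto simp: coordinate_ring_simps)

lemma regular_carrier:
  assumes "zariski_irreducible M" "real_polynomial_function f"
  shows "regular M f \<in> carrier (function_field M)"
  unfolding regular_def
  using assms by (intro domain.fraction_carrier coordinate_ring_domain coordinate_ring_restrict
      coordinate_ring_one_nonzero)

lemma regular_eq_iff:
  assumes "zariski_irreducible M" "real_polynomial_function f" "real_polynomial_function g"
  shows "regular M f = regular M g \<longleftrightarrow> (\<forall>x\<in>M. f x = g x)"
  unfolding regular_def
  using domain.fraction_eq_iff[OF coordinate_ring_domain[OF assms(1)]
      coordinate_ring_restrict[OF assms(2)] coordinate_ring_one_nonzero[OF assms(1)]
      coordinate_ring_restrict[OF assms(3)] coordinate_ring_one_nonzero[OF assms(1)]]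
  by (simp add: coordinate_ring_simps restrict_eq_iff)

lemma regular_mult:
  assumes "zariski_irreducible M" "real_polynomial_function f" "real_polynomial_function g"
  shows "regular M (\<lambda>x. f x * g x) = regular M f \<otimes>\<^bsub>function_field M\<^esub> regular M g"
  unfolding regular_def
  using domain.fraction_mult[OF coordinate_ring_domain[OF assms(1)]
      coordinate_ring_restrict[OF assms(2)] coordinate_ring_one_nonzero[OF assms(1)]
      coordinate_ring_restrict[OF assms(3)] coordinate_ring_one_nonzero[OF assms(1)]]
  by (simp add: coordinate_ring_simps cong: restrict_cong)

lemma regular_add:
  assumes "zariski_irreducible M" "real_polynomial_function f" "real_polynomial_function g"
  shows "regular M (\<lambda>x. f x + g x) = regular M f \<oplus>\<^bsub>function_field M\<^esub> regular M g"
  unfolding regular_def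
  using domain.fraction_add[OF coordinate_ring_domain[OF assms(1)]
      coordinate_ring_restrict[OF assms(2)] coordinate_ring_one_nonzero[OF assms(1)]
      coordinate_ring_restrict[OF assms(3)] coordinate_ring_one_nonzero[OF assms(1)]]
  by (simp add: coordinate_ring_simps cong: restrict_cong)

lemma regular_zero_one:
  assumes "zariski_irreducible M"
  shows "regular M (\<lambda>x. 0) = \<zero>\<^bsub>function_field M\<^esub>" "regular M (\<lambda>x. 1) = \<one>\<^bsub>function_field M\<^esub>"
  by (simp_all add: regular_def domain.fraction_field_zero domain.fraction_field_one
      coordinate_ring_domain[OF assms] coordinate_ring_simps)

lemma function_field_field: "zariski_irreducible M \<Longrightarrow> field (function_field M)"
  by (rule domain.fraction_field_is_field[OF coordinate_ring_domain])

lemma regular_minus: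
  assumes M: "zariski_irreducible M" and f: "real_polynomial_function f"
  shows "regular M (\<lambda>x. - f x) = \<ominus>\<^bsub>function_field M\<^esub> regular M f"
proof -
  interpret F: field "function_field M" by (rule function_field_field[OF M])
  have m: "real_polynomial_function (\<lambda>x. - f x)" using f by (rule real_polynomial_function_minus)
  have "regular M (\<lambda>x. - f x) \<oplus>\<^bsub>function_field M\<^esub> regular M f = \<zero>\<^bsub>function_field M\<^esub>"
    using regular_add[OF M m f] by (simp add: regular_zero_one[OF M])
  then show ?thesis
    using F.minus_equality regular_carrier[OF M f] regular_carrier[OF M m] by metis
qed

text \<open>Pullback along \<open>\<tau>\<close> is an endomorphism of the coordinate ring and its
  own inverse, hence an automorphism, which then extends to fractions.\<close>

lemma involution_automorphism:
  assumes M: "zariski_irreducible M"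
    and \<tau>: "polynomial_function \<tau>" "\<And>x. \<tau> (\<tau> x) = x" "\<And>x. x \<in> M \<Longrightarrow> \<tau> x \<in> M"
  obtains \<phi> where "\<phi> \<in> ring_iso (function_field M) (function_field M)"
    "\<phi> \<in> extensional (carrier (function_field M))"
    "\<And>f. real_polynomial_function f \<Longrightarrow> \<phi> (regular M f) = regular M (\<lambda>x. f (\<tau> x))"
proof -
  let ?R = "coordinate_ring M"
  define \<theta> where "\<theta> = (\<lambda>h. \<lambda>x\<in>M. h (\<tau> x) :: real)"
  have \<theta>r: "\<theta> (restrict f M) = restrict (\<lambda>x. f (\<tau> x)) M" for f
    using \<tau>(3) by (auto simp: \<theta>_def restrict_eq_iff)
  have pf: "real_polynomial_function (\<lambda>x. f (\<tau> x))" if "real_polynomial_function f" for f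
    using real_polynomial_function_compose[OF \<tau>(1) that] by (simp add: o_def)
  have closed: "\<theta> h \<in> carrier ?R" if "h \<in> carrier ?R" for h
    using that coordinate_ring_restrict[OF pf] by (auto simp: coordinate_ring_simps(1)[of h] \<theta>r)
  have inv: "\<theta> (\<theta> h) = h" if "h \<in> carrier ?R" for h
    using that \<tau>(2) by (auto simp: coordinate_ring_simps \<theta>r)
  have iso: "\<theta> \<in> ring_iso ?R ?R"
  proof (rule ring_iso_memI)
    show "bij_betw \<theta> (carrier ?R) (carrier ?R)"
      using closed inv by (intro bij_betw_byWitness[where f' = \<theta>]) auto
    show "\<theta> \<one>\<^bsub>?R\<^esub> = \<one>\<^bsub>?R\<^esub>"
      using \<theta>r[of "\<lambda>x. 1"] by (simp add: coordinate_ring_simps)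
  qed (use closed \<tau>(3) in \<open>auto simp: coordinate_ring_simps(2-5) \<theta>_def restrict_eq_iff\<close>)
  let ?\<phi> = "\<lambda>X\<in>carrier (function_field M). map_prod \<theta> \<theta> ` X"
  show thesis
  proof (rule that[of ?\<phi>])
    show "?\<phi> \<in> ring_iso (function_field M) (function_field M)"
      by (rule domain.fraction_field_map_iso[OF coordinate_ring_domain[OF M] iso])
    show "?\<phi> \<in> extensional (carrier (function_field M))" by simp
    fix f :: "'a \<Rightarrow> real" assume f: "real_polynomial_function f"
    show "?\<phi> (regular M f) = regular M (\<lambda>x. f (\<tau> x))"
      using regular_carrier[OF M f] domain.map_prod_fraction[OF coordinate_ring_domain[OF M] iso
          coordinate_ring_restrict[OF f] coordinate_ring_one_nonzero[OF M]]
      by (simp add: regular_def \<theta>r)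
  qed
qed


section \<open>Sign changes in multiquadratic extensions\<close>

text \<open>Eventual positivity is positivity in the order on polynomials in which the variable
  exceeds all constants, that is, a positive leading coefficient.\<close>

abbreviation evpos :: "real poly \<Rightarrow> bool" where
  "evpos p \<equiv> \<forall>\<^sub>F x in at_top. poly p x > 0"

lemma evpos_mult: "evpos p \<Longrightarrow> evpos q \<Longrightarrow> evpos (p * q)"
  by (erule (1) eventually_elim2) simp

lemma evpos_nonzero: "evpos p \<Longrightarrow> p \<noteq> 0"
  by (auto dest: eventually_happens)

lemma poly_zero_if_eventually_zero:
  fixes p :: "real poly"
  assumes "\<forall>\<^sub>F x in at_top. poly p x = 0"
  shows "p = 0"
proof (rule ccontr)
  assume "p \<noteq> 0"
  then have "finite {x. poly p x = 0}" by (rule poly_roots_finite)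
  obtain N where N: "\<And>x. x \<ge> N \<Longrightarrow> poly p x = 0"
    using assms by (auto simp: eventually_at_top_linorder)
  then have "{N..} \<subseteq> {x. poly p x = 0}" by auto
  then show False
    using \<open>finite {x. poly p x = 0}\<close> infinite_Ici[of N] finite_subset by blast
qed

lemma real_polynomial_function_poly:
  assumes "real_polynomial_function t"
  shows "real_polynomial_function (\<lambda>x. poly p (t x))"
  using assms by (induction p) (auto intro: real_polynomial_function.intros)

lemma sum_list_nonneg_zero:
  fixes f :: "'b \<Rightarrow> real"
  assumes "\<And>z. z \<in> set L \<Longrightarrow> f z \<ge> 0" and "(\<Sum>z\<leftarrow>L. f z) = 0" and "z \<in> set L"
  shows "f z = 0"
  using assms sum_list_nonneg_eq_0_iff[of "map f L"] by fastforce

section \<open>Rings of functions over the polynomials in a nonconstant function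
  \<open>t\<close>\<close>

locale parametrized_set =
  fixes M :: "'a::euclidean_space set" and t :: "'a \<Rightarrow> real"
  assumes irreducible: "zariski_irreducible M"
    and t_poly: "real_polynomial_function t"
    and t_nonconstant: "\<not> t constant_on M"
begin

text \<open>A nonconstant function on an irreducible set is transcendental over the constants: a
  polynomial relation has every value \<open>t x\<close> as a root, and irreducibility allows the
  corresponding linear factor to be dropped.\<close>

lemma poly_t_vanishing:
  assumes "\<forall>x\<in>M. poly p (t x) = 0"
  shows "p = 0"
proof (rule ccontr)
  assume "p \<noteq> 0"
  then show False
    using assms
  proof (induction "degree p" arbitrary: p rule: less_induct)
    case less
    obtain x where "x \<in> M" using irreducible by (auto simp: zariski_irreducible_def)
    then have "poly p (t x) = 0" using less by blast
    then obtain p' where p': "p = [:- t x, 1:] * p'"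
      by (auto simp: poly_eq_0_iff_dvd dvd_def)
    have nz: "p' \<noteq> 0" using less(2) p' by auto
    have "degree ([:- t x, 1:] * p') = degree [:- t x, 1:] + degree p'"
      using nz by (intro degree_mult_eq) auto
    then have "degree p' < degree p" using p' by (simp del: mult_pCons_left)
    then have "\<not> (\<forall>y\<in>M. poly p' (t y) = 0)" using less.hyps nz by blast
    moreover have "(\<forall>y\<in>M. t y - t x = 0) \<or> (\<forall>y\<in>M. poly p' (t y) = 0)"
    proof (rule irreducible_vanishing_mult[OF irreducible])
      show "real_polynomial_function (\<lambda>y. t y - t x)"
        by (rule real_polynomial_function_diff[OF t_poly real_polynomial_function.intros(2)])
      show "real_polynomial_function (\<lambda>y. poly p' (t y))"
        by (rule real_polynomial_function_poly[OF t_poly])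
      show "\<forall>y\<in>M. (t y - t x) * poly p' (t y) = 0"
        using less(3) by (simp add: p' algebra_simps)
    qed
    ultimately have "\<forall>y\<in>M. t y = t x" by auto
    then show False using t_nonconstant by (auto simp: constant_on_def)
  qed
qed

lemma cancel_poly_t:
  assumes "c \<noteq> 0" and "real_polynomial_function f" and "\<forall>x\<in>M. poly c (t x) * f x = 0"
  shows "\<forall>x\<in>M. f x = 0"
  using irreducible_vanishing_mult[OF irreducible real_polynomial_function_poly[OF t_poly] assms(2,3)]
    poly_t_vanishing assms(1) by blast

text \<open>Functions live on the ambient space but matter only on \<open>M\<close>: membership is
  invariant under agreement on \<open>M\<close>, and each member agrees there with a polynomial
  function, so that irreducibility excludes zero divisors.\<close>

definition function_ring :: "('a \<Rightarrow> real) set \<Rightarrow> bool" where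
  "function_ring K \<longleftrightarrow>
    (\<forall>f\<in>K. \<exists>g. real_polynomial_function g \<and> (\<forall>x\<in>M. f x = g x)) \<and>
    (\<forall>f\<in>K. \<forall>g\<in>K. (\<lambda>x. f x + g x) \<in> K \<and> (\<lambda>x. f x * g x) \<in> K) \<and>
    (\<forall>f g. f \<in> K \<longrightarrow> (\<forall>x\<in>M. g x = f x) \<longrightarrow> g \<in> K) \<and>
    (\<forall>p. (\<lambda>x. poly p (t x)) \<in> K)"

definition poly_functions :: "('a \<Rightarrow> real) set" where
  "poly_functions = {f. \<exists>p. \<forall>x\<in>M. f x = poly p (t x)}"

text \<open>Once the square of \<open>w\<close> is a polynomial in \<open>t\<close> on
  \<open>M\<close>, these sums are closed under products. The coefficients \<open>u\<close> and
  \<open>v\<close> may fail to be unique, as \<open>w\<close> may already lie in the fraction field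
  of \<open>K\<close>.\<close>

definition adjoin :: "('a \<Rightarrow> real) set \<Rightarrow> ('a \<Rightarrow> real) \<Rightarrow> ('a \<Rightarrow> real) set" where
  "adjoin K w = {f. \<exists>u\<in>K. \<exists>v\<in>K. \<forall>x\<in>M. f x = u x + v x * w x}"

lemma adjoinI:
  "u \<in> K \<Longrightarrow> v \<in> K \<Longrightarrow> (\<And>x. x \<in> M \<Longrightarrow> f x = u x + v x * w x) \<Longrightarrow> f \<in> adjoin K w"
  unfolding adjoin_def by blast

lemma function_ringD:
  assumes "function_ring K"
  shows "f \<in> K \<Longrightarrow> \<exists>g. real_polynomial_function g \<and> (\<forall>x\<in>M. f x = g x)"
    and "f \<in> K \<Longrightarrow> g \<in> K \<Longrightarrow> (\<lambda>x. f x + g x) \<in> K"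
    and "f \<in> K \<Longrightarrow> g \<in> K \<Longrightarrow> (\<lambda>x. f x * g x) \<in> K"
    and "f \<in> K \<Longrightarrow> (\<And>x. x \<in> M \<Longrightarrow> g x = f x) \<Longrightarrow> g \<in> K"
    and "(\<lambda>x. poly p (t x)) \<in> K"
  using assms unfolding function_ring_def by metis+

lemma function_ring_const: "function_ring K \<Longrightarrow> (\<lambda>x. c) \<in> K"
  using function_ringD(5)[of K "[:c:]"] by simp

lemma function_ring_sum_list:
  "function_ring K \<Longrightarrow> (\<And>z. z \<in> set L \<Longrightarrow> f z \<in> K) \<Longrightarrow> (\<lambda>x. \<Sum>z\<leftarrow>L. f z x) \<in> K"
  by (induction L) (auto intro: function_ringD(2) function_ring_const)

lemma function_ring_cancel:
  assumes K: "function_ring K" and f: "f \<in> K" and g: "g \<in> K"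
    and fg: "\<forall>x\<in>M. f x * g x = 0" and nz: "\<not> (\<forall>x\<in>M. f x = 0)"
  shows "\<forall>x\<in>M. g x = 0"
proof -
  obtain f' g' where f': "real_polynomial_function f'" "\<forall>x\<in>M. f x = f' x"
    and g': "real_polynomial_function g'" "\<forall>x\<in>M. g x = g' x"
    using function_ringD(1)[OF K] f g by metis
  then show ?thesis
    using irreducible_vanishing_mult[OF irreducible f'(1) g'(1)] fg nz by auto
qed

lemma function_ring_poly_functions: "function_ring poly_functions"
  unfolding function_ring_def
proof (intro conjI ballI allI impI)
  fix f assume "f \<in> poly_functions"
  then show "\<exists>g. real_polynomial_function g \<and> (\<forall>x\<in>M. f x = g x)"
    unfolding poly_functions_def using real_polynomial_function_poly[OF t_poly] by blast
next
  fix f g assume "f \<in> poly_functions" "g \<in> poly_functions"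
  then obtain p q where "\<forall>x\<in>M. f x = poly p (t x)" "\<forall>x\<in>M. g x = poly q (t x)"
    unfolding poly_functions_def by auto
  then have "\<forall>x\<in>M. f x + g x = poly (p + q) (t x)" "\<forall>x\<in>M. f x * g x = poly (p * q) (t x)"
    by auto
  then show "(\<lambda>x. f x + g x) \<in> poly_functions" "(\<lambda>x. f x * g x) \<in> poly_functions"
    unfolding poly_functions_def by blast+
qed (auto simp: poly_functions_def)

lemma adjoin_mem:
  assumes K: "function_ring K"
  shows "f \<in> K \<Longrightarrow> f \<in> adjoin K w" "w \<in> adjoin K w"
proof -
  assume "f \<in> K"
  then show "f \<in> adjoin K w"
    using function_ring_const[OF K, of 0] unfolding adjoin_def
    by (intro CollectI bexI[of _ f] bexI[of _ "\<lambda>x. 0"]) auto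
next
  show "w \<in> adjoin K w"
    using function_ring_const[OF K, of 0] function_ring_const[OF K, of 1] unfolding adjoin_def
    by (intro CollectI bexI[of _ "\<lambda>x. 0"] bexI[of _ "\<lambda>x. 1"]) auto
qed

lemma function_ring_adjoin:
  assumes K: "function_ring K" and w: "real_polynomial_function w"
    and a: "\<forall>x\<in>M. (w x)\<^sup>2 = poly a (t x)"
  shows "function_ring (adjoin K w)"
  unfolding function_ring_def
proof (intro conjI ballI allI impI)
  fix f assume "f \<in> adjoin K w"
  then obtain u v where uv: "u \<in> K" "v \<in> K" "\<forall>x\<in>M. f x = u x + v x * w x"
    unfolding adjoin_def by auto
  obtain u' v' where u': "real_polynomial_function u'" "\<forall>x\<in>M. u x = u' x"
    and v': "real_polynomial_function v'" "\<forall>x\<in>M. v x = v' x"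
    using function_ringD(1)[OF K] uv by metis
  have "real_polynomial_function (\<lambda>x. u' x + v' x * w x)" using u' v' w by auto
  moreover have "\<forall>x\<in>M. f x = u' x + v' x * w x" using u' v' uv by auto
  ultimately show "\<exists>g. real_polynomial_function g \<and> (\<forall>x\<in>M. f x = g x)" by blast
next
  fix f g assume "f \<in> adjoin K w" "g \<in> adjoin K w"
  then obtain u v u' v' where uv: "u \<in> K" "v \<in> K" "\<forall>x\<in>M. f x = u x + v x * w x"
    "u' \<in> K" "v' \<in> K" "\<forall>x\<in>M. g x = u' x + v' x * w x"
    unfolding adjoin_def by auto
  have "(\<lambda>x. u x + u' x) \<in> K" "(\<lambda>x. v x + v' x) \<in> K"
    by (intro function_ringD(2)[OF K] uv(1,2,4,5))+
  then show "(\<lambda>x. f x + g x) \<in> adjoin K w"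
    by (rule adjoinI) (use uv in \<open>simp add: algebra_simps\<close>)
  have "(\<lambda>x. u x * u' x + (v x * v' x) * poly a (t x)) \<in> K" "(\<lambda>x. u x * v' x + v x * u' x) \<in> K"
    by (intro function_ringD(2,3,5)[OF K] uv(1,2,4,5))+
  then show "(\<lambda>x. f x * g x) \<in> adjoin K w"
  proof (rule adjoinI)
    fix x assume x: "x \<in> M"
    have A: "poly a (t x) = w x * w x" using a x by (simp add: power2_eq_square)
    show "f x * g x = u x * u' x + v x * v' x * poly a (t x) + (u x * v' x + v x * u' x) * w x"
      unfolding A uv(3)[rule_format, OF x] uv(6)[rule_format, OF x] by (simp add: algebra_simps)
  qed
next
  fix f g assume "f \<in> adjoin K w" and g: "\<forall>x\<in>M. g x = f x"
  then obtain u v where uv: "u \<in> K" "v \<in> K" "\<forall>x\<in>M. f x = u x + v x * w x"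
    unfolding adjoin_def by auto
  then show "g \<in> adjoin K w" using g by (intro adjoinI[OF uv(1,2)]) simp
next
  fix p show "(\<lambda>x. poly p (t x)) \<in> adjoin K w"
    by (rule adjoin_mem(1)[OF K function_ringD(5)[OF K]])
qed

text \<open>Formally real rings of functions: the ordering of the rational functions in \<open>t\<close> in which
  \<open>t\<close> is infinitely large is compatible with sums of squares.\<close>

definition definite :: "('a \<Rightarrow> real) set \<Rightarrow> bool" where
  "definite K \<longleftrightarrow> (\<forall>L. (\<forall>(p, f)\<in>set L. evpos p \<and> f \<in> K) \<longrightarrow>
     (\<forall>x\<in>M. (\<Sum>(p, f)\<leftarrow>L. poly p (t x) * (f x)\<^sup>2) = 0) \<longrightarrow>
     (\<forall>(p, f)\<in>set L. \<forall>x\<in>M. f x = 0))"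

text \<open>The weighted sum of squares becomes one polynomial \<open>S\<close> evaluated at
  \<open>t\<close>, and \<open>S = 0\<close> because \<open>t\<close> is transcendental. Then
  \<open>S\<close> may be evaluated at arbitrarily large numbers, whether or not \<open>t\<close>
  attains them on \<open>M\<close>; all weights are positive there.\<close>

lemma definite_poly_functions: "definite poly_functions"
  unfolding definite_def
proof (intro allI impI)
  fix L assume L: "\<forall>(p, f)\<in>set L. evpos p \<and> f \<in> poly_functions"
    and 0: "\<forall>x\<in>M. (\<Sum>(p, f)\<leftarrow>L. poly p (t x) * (f x)\<^sup>2) = 0"
  have "\<forall>z\<in>set L. \<exists>g. \<forall>x\<in>M. snd z x = poly g (t x)"
    using L by (auto simp: poly_functions_def)
  then obtain G where G: "\<And>z x. z \<in> set L \<Longrightarrow> x \<in> M \<Longrightarrow> snd z x = poly (G z) (t x)"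
    by (metis bchoice)
  define S where "S = (\<Sum>z\<leftarrow>L. fst z * (G z)\<^sup>2)"
  have S: "poly S y = (\<Sum>z\<leftarrow>L. poly (fst z) y * (poly (G z) y)\<^sup>2)" for y
    unfolding S_def by (induction L) auto
  have "poly S (t x) = 0" if "x \<in> M" for x
  proof -
    have "poly S (t x) = (\<Sum>(p, f)\<leftarrow>L. poly p (t x) * (f x)\<^sup>2)"
      unfolding S using G that by (intro arg_cong[where f = sum_list] map_cong) (auto split: prod.splits)
    then show ?thesis using 0 that by simp
  qed
  then have "S = 0" by (intro poly_t_vanishing) blast
  have "\<forall>\<^sub>F y in at_top. \<forall>z\<in>set L. poly (fst z) y > 0"
    using L by (intro eventually_ball_finite) auto
  then have ev: "\<forall>\<^sub>F y in at_top. \<forall>z\<in>set L. poly (G z) y = 0"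
  proof eventually_elim
    case (elim y)
    have nn: "poly (fst z) y * (poly (G z) y)\<^sup>2 \<ge> 0" if "z \<in> set L" for z
      using elim that by (simp add: less_imp_le)
    have 0: "(\<Sum>z\<leftarrow>L. poly (fst z) y * (poly (G z) y)\<^sup>2) = 0"
      using S[of y] \<open>S = 0\<close> by simp
    have "poly (fst z) y * (poly (G z) y)\<^sup>2 = 0" if "z \<in> set L" for z
      by (rule sum_list_nonneg_zero[OF nn 0 that])
    then show ?case using elim by fastforce
  qed
  have "G z = 0" if "z \<in> set L" for z
    using ev that by (intro poly_zero_if_eventually_zero) (auto elim: eventually_mono)
  then show "\<forall>(p, f)\<in>set L. \<forall>x\<in>M. f x = 0"
    using G by force
qed

text \<open>If \<open>w\<close> is a square root of a positive element and the vanishing sum of squares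
  \<open>\<Sum>p (u + v w)\<^sup>2 = U + 2 w V\<close> has \<open>V \<noteq> 0\<close>, then \<open>w\<close> lies in the fraction field of \<open>K\<close>.\<close>

lemma definite_adjoin:
  assumes K: "function_ring K" and def: "definite K"
    and wp: "real_polynomial_function w" and w: "\<forall>x\<in>M. (w x)\<^sup>2 = poly a (t x)"
    and a: "evpos a"
  shows "definite (adjoin K w)"
  unfolding definite_def
proof (intro allI impI)
  fix L assume L: "\<forall>(p, f)\<in>set L. evpos p \<and> f \<in> adjoin K w"
    and 0: "\<forall>x\<in>M. (\<Sum>(p, f)\<leftarrow>L. poly p (t x) * (f x)\<^sup>2) = 0"
  have "\<forall>z\<in>set L. \<exists>h. fst h \<in> K \<and> snd h \<in> K \<and> (\<forall>x\<in>M. snd z x = fst h x + snd h x * w x)"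
    using L by (fastforce simp: adjoin_def)
  then obtain H where H: "\<forall>z\<in>set L. fst (H z) \<in> K \<and> snd (H z) \<in> K \<and>
      (\<forall>x\<in>M. snd z x = fst (H z) x + snd (H z) x * w x)"
    by (metis bchoice)
  define P u v where "P = (\<lambda>z :: real poly \<times> ('a \<Rightarrow> real). fst z)"
    and "u = (\<lambda>z. fst (H z))" and "v = (\<lambda>z. snd (H z))"
  have uK: "u z \<in> K" and vK: "v z \<in> K" and P: "evpos (P z)"
    and f: "\<And>x. x \<in> M \<Longrightarrow> snd z x = u z x + v z x * w x" if "z \<in> set L" for z
    using H L that by (auto simp: u_def v_def P_def)
  define U V where "U = (\<lambda>x. \<Sum>z\<leftarrow>L. poly (P z) (t x) * (u z x * u z x) + poly (P z * a) (t x) * (v z x * v z x))"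
    and "V = (\<lambda>x. \<Sum>z\<leftarrow>L. poly (P z) (t x) * (u z x * v z x))"
  have UK: "U \<in> K" unfolding U_def
    using uK vK by (intro function_ring_sum_list[OF K] function_ringD(2,3,5)[OF K])
  have VK: "V \<in> K" unfolding V_def
    using uK vK by (intro function_ring_sum_list[OF K] function_ringD(2,3,5)[OF K])
  have UV: "U x + 2 * w x * V x = 0" if x: "x \<in> M" for x
  proof -
    have "(\<Sum>(p, f)\<leftarrow>L. poly p (t x) * (f x)\<^sup>2) =
      (\<Sum>z\<leftarrow>L. poly (P z) (t x) * (u z x * u z x) + poly (P z * a) (t x) * (v z x * v z x)
         + 2 * w x * (poly (P z) (t x) * (u z x * v z x)))"
    proof (intro arg_cong[where f = sum_list] map_cong refl)
      fix z assume z: "z \<in> set L"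
      have A: "poly a (t x) = w x * w x" using w x by (simp add: power2_eq_square)
      show "(case z of (p, f) \<Rightarrow> poly p (t x) * (f x)\<^sup>2) =
        poly (P z) (t x) * (u z x * u z x) + poly (P z * a) (t x) * (v z x * v z x)
         + 2 * w x * (poly (P z) (t x) * (u z x * v z x))"
        unfolding case_prod_unfold P_def[symmetric] poly_mult A f[OF z x]
        by (simp add: P_def power2_eq_square algebra_simps)
    qed
    also have "\<dots> = U x + 2 * w x * V x"
      by (simp add: U_def V_def sum_list_addf sum_list_const_mult)
    finally show ?thesis using 0 x by simp
  qed
  show "\<forall>(p, f)\<in>set L. \<forall>x\<in>M. f x = 0"
  proof (cases "\<forall>x\<in>M. V x = 0")
    case True
    \<comment> \<open>With \<open>V = 0\<close> the sum reduces to \<open>U\<close>, itself a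
      weighted sum of squares over \<open>K\<close>. The squares of the \<open>v z\<close> carry the
      weights \<open>P z * a\<close>, positive because \<open>a\<close> is.\<close>
    define L' where "L' = map (\<lambda>z. (P z, u z)) L @ map (\<lambda>z. (P z * a, v z)) L"
    have 1: "\<forall>(p, f)\<in>set L'. evpos p \<and> f \<in> K"
      using uK vK P a evpos_mult by (auto simp: L'_def simp del: poly_mult)
    have 2: "\<forall>x\<in>M. (\<Sum>(p, f)\<leftarrow>L'. poly p (t x) * (f x)\<^sup>2) = 0"
    proof
      fix x assume x: "x \<in> M"
      have "(\<Sum>(p, f)\<leftarrow>L'. poly p (t x) * (f x)\<^sup>2) = U x"
        by (simp add: L'_def U_def sum_list_addf o_def power2_eq_square)
      then show "(\<Sum>(p, f)\<leftarrow>L'. poly p (t x) * (f x)\<^sup>2) = 0" using UV[OF x] True x by simp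
    qed
    have "\<forall>(p, f)\<in>set L'. \<forall>x\<in>M. f x = 0"
      using def 1 2 unfolding definite_def by blast
    then have "u z x = 0" "v z x = 0" if "z \<in> set L" "x \<in> M" for z x
      using that by (auto simp: L'_def)
    then show ?thesis using f by force
  next
    case False
    \<comment> \<open>By \<open>U + 2 * w * V = 0\<close>, multiplying a summand
      \<open>u z + v z * w\<close> by \<open>2 * V\<close> replaces \<open>w\<close> and lands in
      \<open>K\<close>. The scaled sum of squares still vanishes, and \<open>V\<close> is cancelled
      afterwards.\<close>
    define g where "g = (\<lambda>z x. 2 * (u z x * V x) + (- 1) * (v z x * U x))"
    have gK: "g z \<in> K" if "z \<in> set L" for z
      unfolding g_def using uK[OF that] vK[OF that] UK VK
      by (intro function_ringD(2,3)[OF K] function_ring_const[OF K])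
    have g: "g z x = 2 * V x * snd z x" if "z \<in> set L" "x \<in> M" for z x
    proof -
      have "U x = - (2 * w x * V x)" using UV[OF that(2)] by simp
      then show ?thesis using f[OF that] by (simp add: g_def algebra_simps)
    qed
    define L' where "L' = map (\<lambda>z. (P z, g z)) L"
    have 1: "\<forall>(p, f)\<in>set L'. evpos p \<and> f \<in> K"
      using gK P by (auto simp: L'_def)
    have 2: "\<forall>x\<in>M. (\<Sum>(p, f)\<leftarrow>L'. poly p (t x) * (f x)\<^sup>2) = 0"
    proof
      fix x assume x: "x \<in> M"
      have "(\<Sum>(p, f)\<leftarrow>L'. poly p (t x) * (f x)\<^sup>2) =
        (\<Sum>z\<leftarrow>L. (2 * V x)\<^sup>2 * (case z of (p, f) \<Rightarrow> poly p (t x) * (f x)\<^sup>2))"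
        unfolding L'_def map_map
      proof (intro arg_cong[where f = sum_list] map_cong refl)
        fix z assume z: "z \<in> set L"
        show "((\<lambda>(p, f). poly p (t x) * (f x)\<^sup>2) \<circ> (\<lambda>z. (P z, g z))) z =
          (2 * V x)\<^sup>2 * (case z of (p, f) \<Rightarrow> poly p (t x) * (f x)\<^sup>2)"
          using g[OF z x] by (simp add: P_def case_prod_unfold power_mult_distrib)
      qed
      also have "\<dots> = 0" using 0 x by (simp add: sum_list_const_mult)
      finally show "(\<Sum>(p, f)\<leftarrow>L'. poly p (t x) * (f x)\<^sup>2) = 0" .
    qed
    have "\<forall>(p, f)\<in>set L'. \<forall>x\<in>M. f x = 0"
      using def 1 2 unfolding definite_def by blast
    then have g0: "g z x = 0" if "z \<in> set L" "x \<in> M" for z x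
      using that by (auto simp: L'_def)
    have "\<forall>x\<in>M. snd z x = 0" if z: "z \<in> set L" for z
      by (rule function_ring_cancel[OF function_ring_adjoin[OF K wp w] adjoin_mem(1)[OF K VK] _ _ False])
        (use g g0 z L in auto)
    then show ?thesis by force
  qed
qed

text \<open>The relation yields \<open>E\<^sup>2 - q * E'\<^sup>2 = 0\<close>, a vanishing sum of
  squares with the positive weights \<open>1\<close> and \<open>- q\<close>.\<close>

lemma definite_odd_even:
  assumes K: "function_ring K" and def: "definite K"
    and s: "\<forall>x\<in>M. (s x)\<^sup>2 = poly q (t x)" and q: "evpos (- q)"
    and E: "E \<in> K" "E' \<in> K" "\<forall>x\<in>M. E x + s x * E' x = 0"
  shows "\<forall>x\<in>M. E x = 0" "\<forall>x\<in>M. E' x = 0"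
proof -
  have "\<forall>x\<in>M. (\<Sum>(p, f)\<leftarrow>[([:1:], E), (- q, E')]. poly p (t x) * (f x)\<^sup>2) = 0"
  proof
    fix x assume x: "x \<in> M"
    have "E x = - (s x * E' x)" using E(3) x by (simp add: eq_neg_iff_add_eq_0)
    then have "(E x)\<^sup>2 = poly q (t x) * (E' x)\<^sup>2" using s x by (simp add: power_mult_distrib)
    then show "(\<Sum>(p, f)\<leftarrow>[([:1:], E), (- q, E')]. poly p (t x) * (f x)\<^sup>2) = 0" by simp
  qed
  moreover have "\<forall>(p, f)\<in>set [([:1:], E), (- q, E')]. evpos p \<and> f \<in> K"
    using E q by simp
  ultimately have "\<forall>(p, f)\<in>set [([:1:], E), (- q, E')]. \<forall>x\<in>M. f x = 0"
    using def unfolding definite_def by blast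
  then show "\<forall>x\<in>M. E x = 0" "\<forall>x\<in>M. E' x = 0" by simp_all
qed

end

text \<open>As the \<open>q i\<close> are negative for large \<open>t\<close>, the products \<open>s i0 * s i\<close> are square roots of
  positive elements, so they generate a formally real ring, in which no \<open>q i\<close> is a square.\<close>

locale negative_square_roots = parametrized_set M t
  for M :: "'a::euclidean_space set" and t :: "'a \<Rightarrow> real" +
  fixes \<tau> :: "'a \<Rightarrow> 'a" and s :: "'i::finite \<Rightarrow> 'a \<Rightarrow> real" and q :: "'i \<Rightarrow> real poly" and i0 :: 'i
  assumes s_poly: "real_polynomial_function (s i)"
    and s_square: "x \<in> M \<Longrightarrow> (s i x)\<^sup>2 = poly (q i) (t x)"
    and q_negative: "evpos (- q i)"
    and t_\<tau>: "t (\<tau> x) = t x"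
    and s_\<tau>: "s i (\<tau> x) = - s i x"
begin

text \<open>Products with the fixed factor \<open>s i0\<close> suffice:
  \<open>(s i0 * s i) * (s i0 * s j)\<close> is \<open>s i * s j\<close> times the polynomial
  \<open>q i0\<close> in \<open>t\<close>, and denominators in \<open>t\<close> are
  harmless.\<close>

definition even_ring :: "'i list \<Rightarrow> ('a \<Rightarrow> real) set" where
  "even_ring js = fold (\<lambda>j K. adjoin K (\<lambda>x. s i0 x * s j x)) js poly_functions"

lemma even_product:
  "real_polynomial_function (\<lambda>x. s i0 x * s j x)"
  "\<forall>x\<in>M. (s i0 x * s j x)\<^sup>2 = poly (q i0 * q j) (t x)"
  "evpos (q i0 * q j)"
proof -
  show "real_polynomial_function (\<lambda>x. s i0 x * s j x)" using s_poly by blast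
  show "\<forall>x\<in>M. (s i0 x * s j x)\<^sup>2 = poly (q i0 * q j) (t x)"
    by (simp add: power_mult_distrib s_square)
  show "evpos (q i0 * q j)" using evpos_mult[OF q_negative q_negative, of i0 j] by simp
qed

lemma even_ring_fold:
  assumes "function_ring K" "definite K"
  shows "function_ring (fold (\<lambda>j K. adjoin K (\<lambda>x. s i0 x * s j x)) js K) \<and>
    definite (fold (\<lambda>j K. adjoin K (\<lambda>x. s i0 x * s j x)) js K) \<and>
    K \<subseteq> fold (\<lambda>j K. adjoin K (\<lambda>x. s i0 x * s j x)) js K \<and>
    (\<forall>j\<in>set js. (\<lambda>x. s i0 x * s j x) \<in> fold (\<lambda>j K. adjoin K (\<lambda>x. s i0 x * s j x)) js K)"
  using assms
proof (induction js arbitrary: K)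
  case (Cons j js)
  let ?K = "adjoin K (\<lambda>x. s i0 x * s j x)"
  have "function_ring ?K" "definite ?K"
    using Cons.prems even_product by (blast intro: function_ring_adjoin definite_adjoin)+
  note IH = Cons.IH[OF this]
  have "K \<subseteq> ?K" "(\<lambda>x. s i0 x * s j x) \<in> ?K"
    using adjoin_mem[OF Cons.prems(1)] by blast+
  then show ?case using IH by auto
qed simp

definition "even_functions = even_ring (SOME js. set js = (UNIV :: 'i set))"

lemma even_functions:
  shows "function_ring even_functions" "definite even_functions"
    "(\<lambda>x. s i0 x * s j x) \<in> even_functions"
proof -
  have "set (SOME js. set js = (UNIV :: 'i set)) = UNIV"
    by (rule someI_ex) (rule finite_list[OF finite_class.finite_UNIV])
  then show "function_ring even_functions" "definite even_functions"
    "(\<lambda>x. s i0 x * s j x) \<in> even_functions"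
    using even_ring_fold[OF function_ring_poly_functions definite_poly_functions,
        of "SOME js. set js = (UNIV :: 'i set)"]
    unfolding even_functions_def even_ring_def by auto
qed

text \<open>\<open>f\<close> is decomposed into an even and an odd part over a denominator in
  \<open>t\<close>. The value at \<open>\<tau> x\<close> is a separate requirement: \<open>E\<close>
  and \<open>E'\<close> are controlled on \<open>M\<close> only, and \<open>\<tau> x\<close> is not
  yet known to lie there.\<close>

definition splitting :: "('a \<Rightarrow> real) \<Rightarrow> bool" where
  "splitting f \<longleftrightarrow> (\<exists>c E E'. c \<noteq> 0 \<and> E \<in> even_functions \<and> E' \<in> even_functions \<and>
     (\<forall>x\<in>M. poly c (t x) * f x = E x + s i0 x * E' x \<and>
       poly c (t x) * f (\<tau> x) = E x - s i0 x * E' x))"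

lemma splittingI:
  assumes "c \<noteq> 0" "E \<in> even_functions" "E' \<in> even_functions"
    and "\<And>x. x \<in> M \<Longrightarrow> poly c (t x) * f x = E x + s i0 x * E' x"
    and "\<And>x. x \<in> M \<Longrightarrow> poly c (t x) * f (\<tau> x) = E x - s i0 x * E' x"
  shows "splitting f"
  unfolding splitting_def using assms by blast

lemma splitting_const: "splitting (\<lambda>x. c)"
  by (rule splittingI[of 1 "\<lambda>x. c" "\<lambda>x. 0"]) (auto intro: function_ring_const[OF even_functions(1)])

lemma splitting_s: "splitting (s i)"
\<comment> \<open>The denominator is the square of \<open>s i0\<close>, so
  \<open>q i0 * s i = s i0 * (s i0 * s i)\<close> is purely odd.\<close>
proof (rule splittingI[of "q i0" "\<lambda>x. 0" "\<lambda>x. s i0 x * s i x"])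
  show "q i0 \<noteq> 0" using evpos_nonzero[OF q_negative[of i0]] by simp
  show "(\<lambda>x. 0) \<in> even_functions" by (rule function_ring_const[OF even_functions(1)])
  show "(\<lambda>x. s i0 x * s i x) \<in> even_functions" by (rule even_functions(3))
qed (simp_all add: s_\<tau> power2_eq_square flip: s_square)

lemma splitting_even_fraction:
  assumes "c \<noteq> 0" and "\<And>x. x \<in> M \<Longrightarrow> poly c (t x) * f x = poly p (t x) + poly p' (t x) * (s i x * s j x)"
    and \<tau>: "\<And>x. f (\<tau> x) = f x"
  shows "splitting f"
proof -
  note E = even_functions(1)
  define h where "h = (\<lambda>x. poly (q i0 * p) (t x) + poly p' (t x) * ((s i0 x * s i x) * (s i0 x * s j x)))"
  have "h \<in> even_functions"
    unfolding h_def by (intro function_ringD(2,3,5)[OF E] even_functions(3))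
  moreover have "poly (q i0 * c) (t x) * f x = h x" if "x \<in> M" for x
  proof -
    have "poly (q i0 * c) (t x) * f x = poly (q i0) (t x) * (poly p (t x) + poly p' (t x) * (s i x * s j x))"
      using assms(2)[OF that] by simp
    also have "\<dots> = h x"
      using s_square[OF that, of i0, symmetric] by (simp add: h_def power2_eq_square algebra_simps)
    finally show ?thesis .
  qed
  moreover have "q i0 * c \<noteq> 0" using evpos_nonzero[OF q_negative[of i0]] assms(1) by simp
  ultimately show ?thesis
    using function_ring_const[OF E, of 0] by (intro splittingI[of "q i0 * c" h "\<lambda>x. 0"]) (auto simp: \<tau>)
qed

lemma splitting_add:
  assumes "splitting f" "splitting g"
  shows "splitting (\<lambda>x. f x + g x)"
proof -
  note E = even_functions(1)
  obtain c A A' where f: "c \<noteq> 0" "A \<in> even_functions" "A' \<in> even_functions"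
    "\<And>x. x \<in> M \<Longrightarrow> poly c (t x) * f x = A x + s i0 x * A' x"
    "\<And>x. x \<in> M \<Longrightarrow> poly c (t x) * f (\<tau> x) = A x - s i0 x * A' x"
    using assms(1) unfolding splitting_def by blast
  obtain d B B' where g: "d \<noteq> 0" "B \<in> even_functions" "B' \<in> even_functions"
    "\<And>x. x \<in> M \<Longrightarrow> poly d (t x) * g x = B x + s i0 x * B' x"
    "\<And>x. x \<in> M \<Longrightarrow> poly d (t x) * g (\<tau> x) = B x - s i0 x * B' x"
    using assms(2) unfolding splitting_def by blast
  show ?thesis
  proof (rule splittingI[of "c * d" "\<lambda>x. poly d (t x) * A x + poly c (t x) * B x"
        "\<lambda>x. poly d (t x) * A' x + poly c (t x) * B' x"])
    fix x assume x: "x \<in> M"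
    have "poly (c * d) (t x) * (f x + g x) =
      poly d (t x) * (poly c (t x) * f x) + poly c (t x) * (poly d (t x) * g x)"
      by (simp add: algebra_simps)
    then show "poly (c * d) (t x) * (f x + g x) = poly d (t x) * A x + poly c (t x) * B x +
        s i0 x * (poly d (t x) * A' x + poly c (t x) * B' x)"
      unfolding f(4)[OF x] g(4)[OF x] by (simp add: algebra_simps)
    have "poly (c * d) (t x) * (f (\<tau> x) + g (\<tau> x)) =
      poly d (t x) * (poly c (t x) * f (\<tau> x)) + poly c (t x) * (poly d (t x) * g (\<tau> x))"
      by (simp add: algebra_simps)
    then show "poly (c * d) (t x) * (f (\<tau> x) + g (\<tau> x)) = poly d (t x) * A x + poly c (t x) * B x -
        s i0 x * (poly d (t x) * A' x + poly c (t x) * B' x)"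
      unfolding f(5)[OF x] g(5)[OF x] by (simp add: algebra_simps)
  qed (use f(1) g(1) in simp, (intro function_ringD(2,3,5)[OF E] f(2,3) g(2,3))+)
qed

lemma splitting_mult:
  assumes "splitting f" "splitting g"
  shows "splitting (\<lambda>x. f x * g x)"
proof -
  note E = even_functions(1)
  obtain c A A' where f: "c \<noteq> 0" "A \<in> even_functions" "A' \<in> even_functions"
    "\<And>x. x \<in> M \<Longrightarrow> poly c (t x) * f x = A x + s i0 x * A' x"
    "\<And>x. x \<in> M \<Longrightarrow> poly c (t x) * f (\<tau> x) = A x - s i0 x * A' x"
    using assms(1) unfolding splitting_def by blast
  obtain d B B' where g: "d \<noteq> 0" "B \<in> even_functions" "B' \<in> even_functions"
    "\<And>x. x \<in> M \<Longrightarrow> poly d (t x) * g x = B x + s i0 x * B' x"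
    "\<And>x. x \<in> M \<Longrightarrow> poly d (t x) * g (\<tau> x) = B x - s i0 x * B' x"
    using assms(2) unfolding splitting_def by blast
  show ?thesis
  proof (rule splittingI[of "c * d" "\<lambda>x. A x * B x + poly (q i0) (t x) * (A' x * B' x)"
        "\<lambda>x. A x * B' x + A' x * B x"])
    fix x assume x: "x \<in> M"
    have q: "poly (q i0) (t x) = s i0 x * s i0 x"
      using s_square[OF x, of i0] by (simp add: power2_eq_square)
    have "poly (c * d) (t x) * (f x * g x) = (poly c (t x) * f x) * (poly d (t x) * g x)"
      by (simp add: algebra_simps)
    then show "poly (c * d) (t x) * (f x * g x) = A x * B x + poly (q i0) (t x) * (A' x * B' x) +
        s i0 x * (A x * B' x + A' x * B x)"
      unfolding f(4)[OF x] g(4)[OF x] q by (simp add: algebra_simps)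
    have "poly (c * d) (t x) * (f (\<tau> x) * g (\<tau> x)) = (poly c (t x) * f (\<tau> x)) * (poly d (t x) * g (\<tau> x))"
      by (simp add: algebra_simps)
    then show "poly (c * d) (t x) * (f (\<tau> x) * g (\<tau> x)) =
        A x * B x + poly (q i0) (t x) * (A' x * B' x) - s i0 x * (A x * B' x + A' x * B x)"
      unfolding f(5)[OF x] g(5)[OF x] q by (simp add: algebra_simps)
  qed (use f(1) g(1) in simp, (intro function_ringD(2,3,5)[OF E] f(2,3) g(2,3))+)
qed

text \<open>If \<open>f\<close> vanishes on \<open>M\<close>, then so do its even and its odd part
  separately, and with them their difference, which is \<open>f\<close> at the reflected point up to
  the denominator.\<close>

lemma splitting_vanishing:
  assumes f: "splitting f" and p: "real_polynomial_function (\<lambda>x. f (\<tau> x))" and 0: "\<forall>x\<in>M. f x = 0"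
  shows "\<forall>x\<in>M. f (\<tau> x) = 0"
proof -
  obtain c A A' where c: "c \<noteq> 0" "A \<in> even_functions" "A' \<in> even_functions"
    "\<And>x. x \<in> M \<Longrightarrow> poly c (t x) * f x = A x + s i0 x * A' x"
    "\<And>x. x \<in> M \<Longrightarrow> poly c (t x) * f (\<tau> x) = A x - s i0 x * A' x"
    using f unfolding splitting_def by blast
  have "\<forall>x\<in>M. A x + s i0 x * A' x = 0" using 0 c(4) by fastforce
  then have "\<forall>x\<in>M. A x = 0" "\<forall>x\<in>M. A' x = 0"
    using definite_odd_even[OF even_functions(1,2) _ q_negative c(2,3)] s_square by blast+
  then show ?thesis using c(5) by (intro cancel_poly_t[OF c(1) p]) simp
qed

end

section \<open>Configurations of the bipyramid\<close>

lemma dcoord_commute: "dcoord v w = dcoord w v"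
  by (simp add: dcoord_def fun_eq_iff insert_commute)

lemma real_polynomial_function_dcoord: "real_polynomial_function (dcoord v w)"
  unfolding dcoord_def
  by (rule real_polynomial_function.intros(1))
    (rule bounded_linear_compose[OF bounded_linear_vec_nth bounded_linear_fst])

lemma real_polynomial_function_scoord: "real_polynomial_function (scoord i)"
  unfolding scoord_def
  by (rule real_polynomial_function.intros(1))
    (rule bounded_linear_compose[OF bounded_linear_vec_nth bounded_linear_snd])

lemma scoord_cm_map:
  "scoord i (cm_map \<rho>) = vol (\<rho> Top - \<rho> Bottom) (\<rho> (Equator i) - \<rho> Bottom) (\<rho> (Equator (i + 1)) - \<rho> Bottom) / 6"
  by (simp add: scoord_def cm_map_def oriented_volume_def vol_def)

lemma edges_simps [simp]:
  "{Equator i, Top} \<in> edges" "{Equator i, Bottom} \<in> edges" "{Equator i, Equator (i + 1)} \<in> edges"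
  by (auto simp: edges_def)

lemma nonedges:
  "{Top, Bottom} \<notin> edges" "{Equator i, Equator (i + 2)} \<notin> edges" "{Equator i, Equator (i + 3)} \<notin> edges"
  by (auto simp: edges_def doubleton_eq_iff add.assoc)

lemma zariski_closed_Int: "zariski_closed A \<Longrightarrow> zariski_closed B \<Longrightarrow> zariski_closed (A \<inter> B)"
  unfolding zariski_closed_def by (elim exE) (rule_tac x = "F \<union> Fa" in exI, auto)

lemma zariski_closed_INT:
  assumes "\<And>i. i \<in> I \<Longrightarrow> zariski_closed (A i)"
  shows "zariski_closed (\<Inter>i\<in>I. A i)"
proof -
  have "\<forall>i\<in>I. \<exists>F. (\<forall>f\<in>F. real_polynomial_function f) \<and> A i = {x. \<forall>f\<in>F. f x = 0}"
    using assms unfolding zariski_closed_def by blast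
  from bchoice[OF this] obtain F
    where F: "\<forall>i\<in>I. (\<forall>f\<in>F i. real_polynomial_function f) \<and> A i = {x. \<forall>f\<in>F i. f x = 0}"
    by blast
  show ?thesis
    unfolding zariski_closed_def
    by (rule exI[of _ "\<Union>i\<in>I. F i"]) (use F in auto)
qed

lemma zariski_closed_closure: "zariski_closed (zariski_closure S)"
  using zariski_closed_INT[of "{C. zariski_closed C \<and> S \<subseteq> C}" "\<lambda>C. C"]
  by (simp add: zariski_closure_def)

lemma zariski_closed_configuration_space: "zariski_closed (configuration_space lam)"
proof -
  let ?S = "\<lambda>z. {p. dcoord (fst z) (snd z) p - (lam {fst z, snd z})\<^sup>2 = 0}"
  have eq: "configuration_space lam = CM \<inter> (\<Inter>z\<in>{z. {fst z, snd z} \<in> edges}. ?S z)"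
    by (auto simp: configuration_space_def)
  show ?thesis
    unfolding eq CM_def
    by (intro zariski_closed_Int zariski_closed_closure zariski_closed_INT zariski_closed_vanishing
        real_polynomial_function_diff real_polynomial_function_dcoord real_polynomial_function.intros(2))
qed

lemma evpos_quadratic:
  assumes "c > 0"
  shows "evpos [:a, b, c:]"
proof -
  obtain n where "\<forall>x\<ge>n. poly [:a, b, c:] x \<ge> c"
    using poly_pinfty_gt_lc[of "[:a, b, c:]"] assms by auto
  then have "\<forall>x\<ge>n. poly [:a, b, c:] x > 0" using assms by (meson less_le_trans)
  then show ?thesis unfolding eventually_at_top_linorder by blast
qed

locale bipyramid_motion =
  fixes lam :: "vertex set \<Rightarrow> real" and M :: "cm_space set"
  assumes nondegenerate: "nondegenerate_motion lam M"
begin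

abbreviation tb :: "cm_space \<Rightarrow> real" where "tb \<equiv> dcoord Top Bottom"

definition a :: "5 \<Rightarrow> real" where "a i = (lam {Equator i, Top})\<^sup>2"
definition b :: "5 \<Rightarrow> real" where "b i = (lam {Equator i, Bottom})\<^sup>2"
definition e :: "5 \<Rightarrow> real" where "e i = (lam {Equator i, Equator (i + 1)})\<^sup>2"
definition \<beta> :: "5 \<Rightarrow> real" where "\<beta> i = b i - a i"

lemma irreducible: "zariski_irreducible M"
  using nondegenerate by (simp add: nondegenerate_motion_def motion_def irreducible_component_def)

lemma component: "irreducible_component (configuration_space lam) M"
  using nondegenerate by (simp add: nondegenerate_motion_def motion_def)

lemma nonconstant: "v \<noteq> w \<Longrightarrow> {v, w} \<notin> edges \<Longrightarrow> \<not> dcoord v w constant_on M"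
  using nondegenerate by (auto simp: nondegenerate_motion_def)

sublocale parametrized_set M tb
  by standard
    (rule irreducible, rule real_polynomial_function_dcoord, rule nonconstant, simp, rule nonedges)

text \<open>This is the passage from Euclidean identities to \<open>M\<close>: a general point comes
  from a realization, and irreducibility spreads the vanishing. The factor \<open>c\<close> discards
  the finitely many values of \<open>t\<close> at which denominators vanish.\<close>

lemma vanishing_if_vanishing_at_realizations:
  assumes f: "real_polynomial_function f" and "c \<noteq> 0"
    and 0: "\<And>\<rho>. induces \<rho> lam \<Longrightarrow> cm_map \<rho> \<in> M \<Longrightarrow> poly c (tb (cm_map \<rho>)) \<noteq> 0 \<Longrightarrow> f (cm_map \<rho>) = 0"
  shows "\<forall>p\<in>M. f p = 0"
proof -
  obtain Z where Z: "zariski_closed Z" "\<not> M \<subseteq> Z" "\<forall>p\<in>M - Z. \<exists>\<rho>. induces \<rho> lam \<and> p = cm_map \<rho>"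
    using nondegenerate by (auto simp: nondegenerate_motion_def motion_def)
  have "\<forall>p\<in>M - Z. poly c (tb p) * f p = 0"
  proof
    fix p assume p: "p \<in> M - Z"
    then obtain \<rho> where "induces \<rho> lam" "p = cm_map \<rho>" using Z(3) by blast
    then show "poly c (tb p) * f p = 0" using 0[of \<rho>] p by (cases "poly c (tb p) = 0") auto
  qed
  then have "\<forall>p\<in>M. poly c (tb p) * f p = 0"
    by (intro irreducible_vanishing_open[OF irreducible Z(1,2)] real_polynomial_function.intros(4)
        real_polynomial_function_poly t_poly f)
  then show ?thesis by (rule cancel_poly_t[OF \<open>c \<noteq> 0\<close> f])
qed

lemma poly_zero_if_zero_at_realizations:
  assumes "c \<noteq> 0"
    and "\<And>\<rho>. induces \<rho> lam \<Longrightarrow> cm_map \<rho> \<in> M \<Longrightarrow> poly c (tb (cm_map \<rho>)) \<noteq> 0 \<Longrightarrow> poly r (tb (cm_map \<rho>)) = 0"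
  shows "r = 0"
  using vanishing_if_vanishing_at_realizations[OF real_polynomial_function_poly[OF t_poly] assms]
  by (rule poly_t_vanishing)

lemma lengths_positive: "lam {Equator i, Top} > 0" "lam {Equator i, Bottom} > 0" "e i > 0"
proof -
  obtain Z where Z: "\<not> M \<subseteq> Z" "\<forall>p\<in>M - Z. \<exists>\<rho>. induces \<rho> lam \<and> p = cm_map \<rho>"
    using nondegenerate by (auto simp: nondegenerate_motion_def motion_def)
  then obtain \<rho> where \<rho>: "induces \<rho> lam" by blast
  have "lam {v, w} > 0" if "{v, w} \<in> edges" for v w
    using \<rho> that by (auto simp: induces_def realization_def)
  from this[of "Equator i" Top] this[of "Equator i" Bottom] this[of "Equator i" "Equator (i + 1)"]
  show "lam {Equator i, Top} > 0" "lam {Equator i, Bottom} > 0" "e i > 0"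
    by (simp_all add: e_def)
qed

text \<open>With \<open>Bottom\<close> as origin, \<open>D i\<close> and \<open>N i\<close> are the dot products \<open>dot u x\<^sub>i x\<^sub>i\<close> and
  \<open>dot u x\<^sub>i x\<^sub>i\<^sub>+\<^sub>1\<close> of equatorial vertices relative to the axis \<open>u\<close>, and \<open>q i\<close> is the square of
  \<open>s\<^sub>i\<close>, all as polynomials in \<open>t = d\<^sub>T\<^sub>B\<close>.\<close>

definition D :: "5 \<Rightarrow> real poly" where
  "D i = [: - (\<beta> i)\<^sup>2 / 4, b i - \<beta> i / 2, - 1/4 :]"

definition N :: "5 \<Rightarrow> real poly" where
  "N i = [: - \<beta> i * \<beta> (i + 1) / 4, (b i + b (i + 1) - e i) / 2 - (\<beta> i + \<beta> (i + 1)) / 4, - 1/4 :]"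

definition q :: "5 \<Rightarrow> real poly" where
  "q i = (let g = (b i + b (i + 1) - e i) / 2 in
    [: (g * \<beta> i * \<beta> (i + 1) / 2 - b i * (\<beta> (i + 1))\<^sup>2 / 4 - b (i + 1) * (\<beta> i)\<^sup>2 / 4) / 36,
       (b i * b (i + 1) - g\<^sup>2 + g * (\<beta> i + \<beta> (i + 1)) / 2 - b i * \<beta> (i + 1) / 2 - b (i + 1) * \<beta> i / 2) / 36,
       - e i / 144 :])"

lemma D_nonzero [simp]: "D i \<noteq> 0" and N_nonzero [simp]: "N i \<noteq> 0"
  by (simp_all add: D_def N_def)

lemma q_negative: "evpos (- q i)"
proof -
  obtain c0 c1 where "q i = [:c0, c1, - e i / 144:]" unfolding q_def Let_def by blast
  then show ?thesis
    using evpos_quadratic[of "e i / 144" "- c0" "- c1"] lengths_positive(3)[of i] by simp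
qed

lemma q_nonzero [simp]: "q i \<noteq> 0"
  using evpos_nonzero[OF q_negative[of i]] by simp

text \<open>Whereas \<open>N\<close> substitutes the constant length of an equatorial edge, this
  function keeps the coordinate of the pair and thus also covers the diagonals.\<close>

definition dotp :: "5 \<Rightarrow> 5 \<Rightarrow> cm_space \<Rightarrow> real" where
  "dotp i j p = tb p * (b i + b j - dcoord (Equator i) (Equator j) p) / 2
     - (tb p + \<beta> i) * (tb p + \<beta> j) / 4"

end

locale motion_point = bipyramid_motion +
  fixes \<rho> :: configuration
  assumes \<rho>: "induces \<rho> lam" and \<rho>M: "cm_map \<rho> \<in> M"
begin

abbreviation "p \<equiv> cm_map \<rho>"
abbreviation "u \<equiv> \<rho> Top - \<rho> Bottom"
abbreviation "x i \<equiv> \<rho> (Equator i) - \<rho> Bottom"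

lemma axis_square: "u \<bullet> u = tb p"
  by (simp add: dcoord_cm_map power2_norm_eq_inner)

lemma edge_square: "{v, w} \<in> edges \<Longrightarrow> (norm (\<rho> v - \<rho> w))\<^sup>2 = (lam {v, w})\<^sup>2"
  using \<rho> by (simp add: induces_def)

lemma x_square: "x i \<bullet> x i = b i"
  using edge_square[of "Equator i" Bottom] by (simp add: b_def power2_norm_eq_inner)

lemma x_axis: "x i \<bullet> u = (tb p + \<beta> i) / 2"
proof -
  \<comment> \<open>\<open>x i - u\<close> points from \<open>Top\<close> to the vertex. Expanding
    its square is where \<open>\<beta> i = b i - a i\<close> comes from; it measures the height of
    the vertex above the plane bisecting the axis.\<close>
  have "(x i - u) \<bullet> (x i - u) = a i"
    using edge_square[of "Equator i" Top] by (simp add: a_def power2_norm_eq_inner)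
  then show ?thesis
    using x_square[of i] axis_square by (simp add: \<beta>_def inner_diff_left inner_diff_right inner_commute)
qed

lemma x_x:
  assumes "i \<noteq> j"
  shows "x i \<bullet> x j = (b i + b j - dcoord (Equator i) (Equator j) p) / 2"
proof -
  have "(x i - x j) \<bullet> (x i - x j) = dcoord (Equator i) (Equator j) p"
    using assms by (simp add: dcoord_cm_map power2_norm_eq_inner)
  then show ?thesis
    using x_square[of i] x_square[of j] by (simp add: inner_diff_left inner_diff_right inner_commute)
qed

lemma x_x_edge: "x i \<bullet> x (i + 1) = (b i + b (i + 1) - e i) / 2"
  using x_x[of i "i + 1"] edge_square[of "Equator i" "Equator (i + 1)"]
  by (simp add: dcoord_cm_map e_def)

lemma dot_x_x: "dot u (x i) (x i) = poly (D i) (tb p)"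
  by (simp add: dot_def axis_square x_square x_axis D_def power2_eq_square field_simps)

lemma dot_x: "i \<noteq> j \<Longrightarrow> dot u (x i) (x j) = dotp i j p"
  by (simp add: dot_def axis_square x_x x_axis dotp_def)

lemma dot_x_edge: "dot u (x i) (x (i + 1)) = poly (N i) (tb p)"
  unfolding dot_def axis_square x_x_edge x_axis
  by (simp add: N_def power2_eq_square field_simps)

lemma vol_x_edge: "vol u (x i) (x (i + 1)) = 6 * scoord i p"
  by (simp add: scoord_cm_map)

lemma scoord_square: "(scoord i p)\<^sup>2 = poly (q i) (tb p)"
proof -
  have "(6 * scoord i p)\<^sup>2 = 36 * poly (q i) (tb p)"
    unfolding vol_x_edge[symmetric] gram_vol axis_square x_square x_x_edge x_axis
    by (simp add: q_def Let_def power2_eq_square field_simps)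
  then show ?thesis by (simp add: power_mult_distrib)
qed

end

context bipyramid_motion
begin

lemma motion_pointI: "induces \<rho> lam \<Longrightarrow> cm_map \<rho> \<in> M \<Longrightarrow> motion_point lam M \<rho>"
  by unfold_locales

lemma scoord_square_M: "\<forall>p\<in>M. (scoord i p)\<^sup>2 = poly (q i) (tb p)"
proof -
  have "\<forall>p\<in>M. (scoord i p)\<^sup>2 - poly (q i) (tb p) = 0"
    by (rule vanishing_if_vanishing_at_realizations[of _ 1])
      (auto intro!: real_polynomial_function_diff real_polynomial_function_power
        real_polynomial_function_scoord real_polynomial_function_poly t_poly simp: motion_point.scoord_square[OF motion_pointI])
  then show ?thesis by simp
qed

lemma scoord_nonzero: "\<not> (\<forall>p\<in>M. scoord i p = 0)"
proof
  assume "\<forall>p\<in>M. scoord i p = 0"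
  then have "\<forall>p\<in>M. poly (q i) (tb p) = 0" using scoord_square_M[of i] by fastforce
  then show False using poly_t_vanishing q_nonzero by blast
qed

text \<open>This is \<open>dot_dot\<close> with the intermediate vertex \<open>i + 1\<close>. The
  factor 36 appears because each volume over the axis is \<open>6\<close> times a coordinate
  \<open>scoord\<close>.\<close>

lemma diagonal_M:
  "\<forall>p\<in>M. poly (D (i + 1)) (tb p) * dotp i (i + 2) p =
     poly (N i * N (i + 1)) (tb p) - 36 * tb p * (scoord i p * scoord (i + 1) p)"
proof -
  let ?f = "\<lambda>p. poly (D (i + 1)) (tb p) * dotp i (i + 2) p -
     (poly (N i * N (i + 1)) (tb p) - 36 * tb p * (scoord i p * scoord (i + 1) p))"
  have "\<forall>p\<in>M. ?f p = 0"
  proof (rule vanishing_if_vanishing_at_realizations[of _ 1])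
    show "real_polynomial_function ?f"
      unfolding dotp_def
      by (intro real_polynomial_function_diff real_polynomial_function.intros(2,3,4)
          real_polynomial_function_divide real_polynomial_function_poly
          real_polynomial_function_scoord real_polynomial_function_dcoord)
    fix \<rho> assume "induces \<rho> lam" "cm_map \<rho> \<in> M"
    then interpret motion_point lam M \<rho> by (rule motion_pointI)
    show "?f (cm_map \<rho>) = 0"
      using dot_dot[of u "x i" "x (i + 1)" "x (i + 2)"] dot_x_edge[of i] dot_x_edge[of "i + 1"]
        vol_x_edge[of i] vol_x_edge[of "i + 1"] axis_square dot_x_x[of "i + 1"] dot_x[of i "i + 2"]
      by (simp add: add_mod5)
  qed simp
  then show ?thesis by simp
qed

end

section \<open>The reflection\<close>

definition reflection :: "cm_space \<Rightarrow> cm_space" where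
  "reflection p = (fst p, - snd p)"

lemma reflection_simps [simp]:
  "reflection (reflection p) = p" "dcoord v w (reflection p) = dcoord v w p"
  "scoord i (reflection p) = - scoord i p"
  by (simp_all add: reflection_def dcoord_def scoord_def)

lemma polynomial_function_reflection: "polynomial_function reflection"
proof -
  have "bounded_linear reflection"
    unfolding reflection_def [abs_def]
    by (intro bounded_linear_Pair bounded_linear_fst bounded_linear_minus bounded_linear_snd)
  then show ?thesis by (rule polynomial_function_bounded_linear)
qed

lemma cm_space_expand:
  fixes p :: cm_space
  shows "p = (\<Sum>v\<in>UNIV. (fst p $ v) *\<^sub>R (axis v 1, 0)) + (\<Sum>i\<in>UNIV. (snd p $ i) *\<^sub>R (0, axis i 1))"
  by (rule prod_eqI)
    (simp_all add: fst_sum snd_sum basis_expansion[unfolded scalar_mult_eq_scaleR] vec_eq_iff axis_def if_distrib cong: if_cong)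

lemma equator_cases:
  fixes i j :: 5
  assumes "i \<noteq> j"
  obtains "j = i + 1" | "i = j + 1" | "j = i + 2" | "i = j + 2"
proof -
  have "j = i \<or> j = i + 1 \<or> j = i + 2 \<or> j = i + 3 \<or> j = i + 4" by (rule mod5_offset)
  moreover have "i = i + 3 + 2" "i = i + 4 + 1" by (simp_all add: add_mod5)
  ultimately show thesis using assms that by metis
qed

context bipyramid_motion
begin

sublocale negative_square_roots M tb reflection scoord q 0
  by standard (use real_polynomial_function_scoord scoord_square_M q_negative in auto)

lemma edge_constant:
  assumes "p \<in> M" "{v, w} \<in> edges"
  shows "dcoord v w p = (lam {v, w})\<^sup>2"
  using component assms by (auto simp: irreducible_component_def configuration_space_def)

lemma splitting_edge: "{v, w} \<in> edges \<Longrightarrow> splitting (dcoord v w)"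
  by (rule splitting_even_fraction[of 1 _ "[:(lam {v, w})\<^sup>2:]" 0]) (simp_all add: edge_constant)

lemma splitting_axis: "splitting tb"
  by (rule splitting_even_fraction[of 1 _ "[:0, 1:]" 0]) simp_all

lemma splitting_diagonal: "splitting (dcoord (Equator i) (Equator (i + 2)))"
proof (rule splitting_even_fraction)
  \<comment> \<open>\<open>R\<close> collects the terms of \<open>dotp i (i + 2)\<close> that do not
    involve the diagonal; the diagonal itself enters with the factor
    \<open>- tb / 2\<close>.\<close>
  define R where "R = [: - \<beta> i * \<beta> (i + 2) / 4, (b i + b (i + 2)) / 2 - (\<beta> i + \<beta> (i + 2)) / 4, - 1/4 :]"
  show "D (i + 1) * [:0, 1/2:] \<noteq> 0" by simp
  fix p assume p: "p \<in> M"
  have "tb p / 2 * dcoord (Equator i) (Equator (i + 2)) p = poly R (tb p) - dotp i (i + 2) p"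
    by (simp add: dotp_def R_def power2_eq_square field_simps)
  note d = this
  have "poly (D (i + 1) * [:0, 1/2:]) (tb p) * dcoord (Equator i) (Equator (i + 2)) p =
    poly (D (i + 1)) (tb p) * (tb p / 2 * dcoord (Equator i) (Equator (i + 2)) p)"
    by simp
  also have "\<dots> = poly (D (i + 1) * R) (tb p) - poly (D (i + 1)) (tb p) * dotp i (i + 2) p"
    unfolding d by (simp add: right_diff_distrib)
  also have "\<dots> = poly (D (i + 1) * R - N i * N (i + 1)) (tb p) + poly [:0, 36:] (tb p) * (scoord i p * scoord (i + 1) p)"
    using diagonal_M[of i] p by simp
  finally show "poly (D (i + 1) * [:0, 1/2:]) (tb p) * dcoord (Equator i) (Equator (i + 2)) p =
    poly (D (i + 1) * R - N i * N (i + 1)) (tb p) + poly [:0, 36:] (tb p) * (scoord i p * scoord (i + 1) p)" .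
qed simp

lemma splitting_dcoord:
  assumes "v \<noteq> w"
  shows "splitting (dcoord v w)"
proof -
  have tb: "splitting (dcoord Bottom Top)"
    using splitting_axis by (simp add: dcoord_commute[of Bottom])
  have eq: "splitting (dcoord (Equator i) (Equator j))" if "i \<noteq> j" for i j
    using that
  proof (cases rule: equator_cases)
    case 2
    then show ?thesis using splitting_edge[of "Equator j" "Equator (j + 1)"] by (simp add: dcoord_commute[of _ "Equator j"])
  next
    case 4
    then show ?thesis using splitting_diagonal[of j] by (simp add: dcoord_commute[of _ "Equator j"])
  qed (use splitting_edge splitting_diagonal in auto)
  have pole: "splitting (dcoord Top (Equator i))" "splitting (dcoord Bottom (Equator i))" for i
    using splitting_edge[of "Equator i" Top] splitting_edge[of "Equator i" Bottom]
    by (simp_all add: dcoord_commute[of _ "Equator i"])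
  show ?thesis
    using assms tb eq pole splitting_axis splitting_edge
    by (cases v; cases w) auto
qed

lemma splitting_sum:
  "finite I \<Longrightarrow> (\<And>i. i \<in> I \<Longrightarrow> splitting (f i)) \<Longrightarrow> splitting (\<lambda>x. \<Sum>i\<in>I. f i x)"
  by (induction I rule: finite_induct) (auto intro: splitting_const splitting_add)

text \<open>All coordinates split and splitting respects sums and products. By
  \<open>splitting_vanishing\<close> the vanishing ideal of \<open>M\<close> is therefore stable
  under the reflection.\<close>

lemma splitting_polynomial:
  assumes "real_polynomial_function f"
  shows "splitting f"
  using assms
proof (induction f rule: real_polynomial_function.induct)
  case (linear f)
  interpret bounded_linear f by fact
  have f: "f = (\<lambda>p. (\<Sum>v\<in>UNIV. (fst p $ v) * f (axis v 1, 0)) + (\<Sum>i\<in>UNIV. (snd p $ i) * f (0, axis i 1)))"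
  proof
    fix p
    show "f p = (\<Sum>v\<in>UNIV. (fst p $ v) * f (axis v 1, 0)) + (\<Sum>i\<in>UNIV. (snd p $ i) * f (0, axis i 1))"
      by (subst cm_space_expand) (simp only: add sum scaleR real_scaleR_def)
  qed
  have d: "splitting (\<lambda>p. fst p $ e)" for e
  proof -
    obtain v w where "v \<noteq> w" "Rep_vpair e = {v, w}"
      using Rep_vpair[of e] by (auto simp: card_2_iff)
    then have "(\<lambda>p. fst p $ e) = dcoord v w"
      by (auto simp: dcoord_def fun_eq_iff dest: arg_cong[where f = Abs_vpair] simp: Rep_vpair_inverse)
    then show ?thesis using splitting_dcoord \<open>v \<noteq> w\<close> by simp
  qed
  have s: "splitting (\<lambda>p. snd p $ i)" for i
    using splitting_s[of i] unfolding scoord_def .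
  show ?case
    by (subst f) (intro splitting_add splitting_sum splitting_mult d s splitting_const finite_class.finite_UNIV)
qed (auto intro: splitting_const splitting_add splitting_mult)

lemma reflection_M:
  assumes "p \<in> M"
  shows "reflection p \<in> M"
proof (rule irreducible_component_vanishing[OF component zariski_closed_configuration_space])
  fix f :: "cm_space \<Rightarrow> real" assume f: "real_polynomial_function f" "\<forall>x\<in>M. f x = 0"
  then show "f (reflection p) = 0"
    using splitting_vanishing[OF splitting_polynomial[OF f(1)] _ f(2)]
      real_polynomial_function_compose[OF polynomial_function_reflection f(1)] assms
    by (auto simp: o_def)
qed

section \<open>The Galois group of a motion\<close>

abbreviation "F \<equiv> function_field M"
abbreviation "reg \<equiv> regular M"

lemma base_field_generators:
  "insert (reg tb) (range (\<lambda>c. reg (\<lambda>_. c))) \<subseteq> carrier F"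
  using regular_carrier[OF irreducible] t_poly real_polynomial_function.intros(2) by auto

lemma base_field_mem: "reg tb \<in> base_field M" "reg (\<lambda>_. c) \<in> base_field M"
  unfolding base_field_def by (auto intro: generate_field.incl)

text \<open>A relation between polynomial functions lets the effect of \<open>\<phi>\<close> on a
  composite expression be assembled by introduction rules that follow its syntax.\<close>

definition corresponds where
  "corresponds \<phi> f g \<longleftrightarrow> real_polynomial_function f \<and> real_polynomial_function g \<and> \<phi> (reg f) = reg g"

context
  fixes \<phi> assumes \<phi>: "\<phi> \<in> galois_automorphisms F (base_field M)"
begin

lemma galois_iso: "\<phi> \<in> ring_iso F F" and galois_fixed: "X \<in> base_field M \<Longrightarrow> \<phi> X = X"
  using \<phi> by (auto simp: galois_automorphisms_def)

lemma galois_ring_hom: "\<phi> \<in> ring_hom F F"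
  using galois_iso by (simp add: ring_iso_def)

lemma corresponds_add:
  "corresponds \<phi> f g \<Longrightarrow> corresponds \<phi> f' g' \<Longrightarrow> corresponds \<phi> (\<lambda>x. f x + f' x) (\<lambda>x. g x + g' x)"
  using ring_hom_add[OF galois_ring_hom]
  by (auto simp: corresponds_def regular_add[OF irreducible] regular_carrier[OF irreducible])

lemma corresponds_mult:
  "corresponds \<phi> f g \<Longrightarrow> corresponds \<phi> f' g' \<Longrightarrow> corresponds \<phi> (\<lambda>x. f x * f' x) (\<lambda>x. g x * g' x)"
  using ring_hom_mult[OF galois_ring_hom]
  by (auto simp: corresponds_def regular_mult[OF irreducible] regular_carrier[OF irreducible])

lemma corresponds_const: "corresponds \<phi> (\<lambda>_. c) (\<lambda>_. c)"
  using galois_fixed base_field_mem(2) by (auto simp: corresponds_def)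

lemma corresponds_poly: "corresponds \<phi> (\<lambda>x. poly r (tb x)) (\<lambda>x. poly r (tb x))"
proof (induction r)
  case 0
  then show ?case using corresponds_const[of 0] by simp
next
  case (pCons c r)
  have "corresponds \<phi> tb tb"
    using galois_fixed base_field_mem(1) t_poly by (auto simp: corresponds_def)
  then show ?case
    using corresponds_add[OF corresponds_const[of c] corresponds_mult[OF _ pCons.IH]] by simp
qed

lemma corresponds_unique:
  "corresponds \<phi> f g \<Longrightarrow> corresponds \<phi> f' g' \<Longrightarrow> \<forall>x\<in>M. f x = f' x \<Longrightarrow> \<forall>x\<in>M. g x = g' x"
  unfolding corresponds_def using regular_eq_iff[OF irreducible] by metis

definition sign :: "5 \<Rightarrow> real" where
  "sign i = (if sign_tuple M \<phi> $ i = 1 then - 1 else 1)"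

text \<open>The square of the volume is \<open>q i\<close> at \<open>t\<close>, hence fixed by
  \<open>\<phi>\<close>, and an element of a field has at most two square roots.\<close>

lemma corresponds_scoord: "corresponds \<phi> (scoord i) (\<lambda>x. sign i * scoord i x)"
proof -
  interpret F: field F by (rule function_field_field[OF irreducible])
  note s = real_polynomial_function_scoord[of i]
  let ?S = "reg (scoord i)"
  have S: "?S \<in> carrier F" "\<phi> ?S \<in> carrier F"
    using regular_carrier[OF irreducible s] ring_hom_closed[OF galois_ring_hom] by auto
  have "reg (\<lambda>x. scoord i x * scoord i x) = reg (\<lambda>x. poly (q i) (tb x))"
    using s scoord_square_M[of i] regular_eq_iff[OF irreducible _ real_polynomial_function_poly[OF t_poly]]
    by (simp add: real_polynomial_function.intros(4) power2_eq_square)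
  then have "\<phi> (?S \<otimes>\<^bsub>F\<^esub> ?S) = ?S \<otimes>\<^bsub>F\<^esub> ?S"
    using corresponds_poly[of "q i"] regular_mult[OF irreducible s s] by (simp add: corresponds_def)
  then have sq: "\<phi> ?S \<otimes>\<^bsub>F\<^esub> \<phi> ?S = ?S \<otimes>\<^bsub>F\<^esub> ?S"
    using ring_hom_mult[OF galois_ring_hom S(1) S(1)] by simp
  have "(\<phi> ?S \<ominus>\<^bsub>F\<^esub> ?S) \<otimes>\<^bsub>F\<^esub> (\<phi> ?S \<oplus>\<^bsub>F\<^esub> ?S) = \<phi> ?S \<otimes>\<^bsub>F\<^esub> \<phi> ?S \<ominus>\<^bsub>F\<^esub> ?S \<otimes>\<^bsub>F\<^esub> ?S"
    using S by algebra
  also have "\<dots> = \<zero>\<^bsub>F\<^esub>" unfolding sq using S by algebra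
  finally have z: "(\<phi> ?S \<ominus>\<^bsub>F\<^esub> ?S) \<otimes>\<^bsub>F\<^esub> (\<phi> ?S \<oplus>\<^bsub>F\<^esub> ?S) = \<zero>\<^bsub>F\<^esub>" .
  have "\<phi> ?S \<ominus>\<^bsub>F\<^esub> ?S = \<zero>\<^bsub>F\<^esub> \<or> \<phi> ?S \<oplus>\<^bsub>F\<^esub> ?S = \<zero>\<^bsub>F\<^esub>"
    by (rule F.integral[OF z]) (use S in auto)
  then have "\<phi> ?S = ?S \<or> \<phi> ?S = \<ominus>\<^bsub>F\<^esub> ?S"
    using S F.minus_equality F.r_right_minus_eq by metis
  moreover have "sign i = - 1 \<longleftrightarrow> \<phi> ?S = \<ominus>\<^bsub>F\<^esub> ?S"
    by (simp add: sign_def sign_tuple_def)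
  moreover have "sign i = 1 \<or> sign i = - 1" by (simp add: sign_def)
  ultimately have "\<phi> ?S = reg (\<lambda>x. sign i * scoord i x)"
    using regular_minus[OF irreducible s] by fastforce
  then show ?thesis
    using s by (auto simp: corresponds_def)
qed

lemma sign_cases: "sign i = 1 \<or> sign i = - 1"
  by (simp add: sign_def)

end

lemma scoord_neq_minus:
  "reg (\<lambda>x. c * scoord i x) = reg (\<lambda>x. c' * scoord i x) \<longleftrightarrow> c = c'"
proof -
  have "c = c'" if "\<forall>x\<in>M. c * scoord i x = c' * scoord i x"
  proof -
    obtain x where x: "x \<in> M" "scoord i x \<noteq> 0" using scoord_nonzero by blast
    then show ?thesis using that by fastforce
  qed
  moreover have "real_polynomial_function (\<lambda>x. c * scoord i x)" for c
    by (rule real_polynomial_function.intros(4)[OF real_polynomial_function.intros(2) real_polynomial_function_scoord])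
  ultimately show ?thesis using regular_eq_iff[OF irreducible] by blast
qed

lemma sign_tuple_eqI:
  assumes "\<And>i. \<phi> (reg (scoord i)) = reg (\<lambda>x. c i * scoord i x)"
  shows "sign_tuple M \<phi> $ i = (if c i = - 1 then 1 else 0)"
  using scoord_neq_minus[of "c i" i "- 1"] regular_minus[OF irreducible real_polynomial_function_scoord]
  by (simp add: sign_tuple_def assms)

lemma all_ones_galois: "vector [1, 1, 1, 1, 1] \<in> galois_group M"
proof -
  obtain \<phi> where \<phi>: "\<phi> \<in> ring_iso F F" "\<phi> \<in> extensional (carrier F)"
    "\<And>f. real_polynomial_function f \<Longrightarrow> \<phi> (reg f) = reg (\<lambda>x. f (reflection x))"
    using involution_automorphism[OF irreducible polynomial_function_reflection _ reflection_M]
    by auto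
  interpret F: field F by (rule function_field_field[OF irreducible])
  have "\<phi> X = X" if "X \<in> base_field M" for X
    using that unfolding base_field_def
    by (rule F.generate_field_fixed[OF \<phi>(1) base_field_generators, rotated])
      (auto simp: \<phi>(3) t_poly real_polynomial_function.intros(2))
  then have "\<phi> \<in> galois_automorphisms F (base_field M)"
    using \<phi> by (simp add: galois_automorphisms_def)
  moreover have "sign_tuple M \<phi> = vector [1, 1, 1, 1, 1]"
    using sign_tuple_eqI[of \<phi> "\<lambda>_. - 1"]
    by (simp add: vec_eq_iff vector_ones \<phi>(3) real_polynomial_function_scoord)
  ultimately show ?thesis unfolding galois_group_def by (metis imageI)
qed

lemma galois_group_add:
  assumes "g \<in> galois_group M" "h \<in> galois_group M"
  shows "g + h \<in> galois_group M"
proof -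
  obtain \<phi> \<psi> where \<phi>: "\<phi> \<in> galois_automorphisms F (base_field M)" "g = sign_tuple M \<phi>"
    and \<psi>: "\<psi> \<in> galois_automorphisms F (base_field M)" "h = sign_tuple M \<psi>"
    using assms by (auto simp: galois_group_def)
  interpret F: field F by (rule function_field_field[OF irreducible])
  \<comment> \<open>The composite is cut down to the carrier to make it extensional. Its signs are
    products of signs, which turns into addition of bits.\<close>
  define \<omega> where "\<omega> = (\<lambda>X\<in>carrier F. \<phi> (\<psi> X))"
  have iso: "(\<lambda>X. \<phi> (\<psi> X)) \<in> ring_iso F F"
    using ring_iso_set_trans[OF galois_iso[OF \<psi>(1)] galois_iso[OF \<phi>(1)]] by (simp add: o_def)
  have "\<omega> \<in> ring_iso F F"
    unfolding \<omega>_def by (rule F.ring_iso_restrict[OF iso]) simp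
  moreover have "base_field M \<subseteq> carrier F"
    unfolding base_field_def by (rule F.generate_field_incl[OF base_field_generators])
  ultimately have \<omega>: "\<omega> \<in> galois_automorphisms F (base_field M)"
    using galois_fixed[OF \<phi>(1)] galois_fixed[OF \<psi>(1)] by (auto simp: galois_automorphisms_def \<omega>_def)
  have "\<omega> (reg (scoord i)) = reg (\<lambda>x. (sign \<psi> i * sign \<phi> i) * scoord i x)" for i
  proof -
    have "\<omega> (reg (scoord i)) = \<phi> (reg (\<lambda>x. sign \<psi> i * scoord i x))"
      using corresponds_scoord[OF \<psi>(1), of i] regular_carrier[OF irreducible real_polynomial_function_scoord]
      by (simp add: \<omega>_def corresponds_def)
    also have "\<dots> = reg (\<lambda>x. sign \<psi> i * (sign \<phi> i * scoord i x))"
      using corresponds_mult[OF \<phi>(1) corresponds_const[OF \<phi>(1)] corresponds_scoord[OF \<phi>(1)]]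
      by (simp add: corresponds_def)
    finally show ?thesis by (simp add: mult.assoc)
  qed
  then have "sign_tuple M \<omega> $ i = (if sign \<psi> i * sign \<phi> i = - 1 then 1 else 0)" for i
    by (rule sign_tuple_eqI)
  moreover have "sign_tuple M \<phi> $ i = (if sign \<phi> i = - 1 then 1 else 0)"
    "sign_tuple M \<psi> $ i = (if sign \<psi> i = - 1 then 1 else 0)" for i
    by (auto simp: sign_def[OF \<phi>(1)] sign_def[OF \<psi>(1)])
  ultimately have "sign_tuple M \<omega> $ i = (g + h) $ i" for i
    using sign_cases[OF \<phi>(1), of i] sign_cases[OF \<psi>(1), of i] by (auto simp: \<phi>(2) \<psi>(2))
  then have "sign_tuple M \<omega> = g + h" by (simp add: vec_eq_iff)
  then show ?thesis
    using \<omega> unfolding galois_group_def by (metis imageI)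
qed

end

section \<open>Excluding adjacent sign changes\<close>

lemma order_linear_product:
  fixes r r' c :: "'a::field"
  assumes "c \<noteq> 0" "r \<noteq> r'"
  shows "Polynomial.order r (Polynomial.smult c ([:- r, 1:] * [:- r', 1:])) = 1"
proof -
  have nz: "[:- r, 1:] * [:- r', 1:] \<noteq> 0" by (simp del: mult_pCons_left)
  have "Polynomial.order r (Polynomial.smult c ([:- r, 1:] * [:- r', 1:])) = Polynomial.order r ([:- r, 1:] * [:- r', 1:])"
    using assms(1) by (rule order_smult)
  also have "\<dots> = Polynomial.order r [:- r, 1:] + Polynomial.order r [:- r', 1:]" by (rule order_mult[OF nz])
  also have "Polynomial.order r [:- r, 1:] = 1" using order_power_n_n[of r 1] by simp
  also have "Polynomial.order r [:- r', 1:] = 0" using assms(2) by (intro order_0I) simp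
  finally show ?thesis by simp
qed

text \<open>Parity of orders: at a simple root of \<open>B\<close> the right-hand side has odd
  order, which the square on the left cannot supply without a zero of \<open>A\<close>.\<close>

lemma root_if_quotient_square:
  fixes A B X Y :: "'a::field poly"
  assumes eq: "A * X\<^sup>2 = B * Y\<^sup>2" and nz: "A \<noteq> 0" "B \<noteq> 0" "X \<noteq> 0" "Y \<noteq> 0" and "Polynomial.order r B = 1"
  shows "poly A r = 0"
proof (rule ccontr)
  assume "poly A r \<noteq> 0"
  then have "Polynomial.order r A = 0" by (rule order_0I)
  have "Polynomial.order r (A * X\<^sup>2) = 2 * Polynomial.order r X"
    using nz \<open>Polynomial.order r A = 0\<close> by (simp add: order_mult power2_eq_square)
  moreover have "Polynomial.order r (B * Y\<^sup>2) = 1 + 2 * Polynomial.order r Y"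
    using nz assms(6) by (simp add: order_mult power2_eq_square)
  ultimately have "2 * Polynomial.order r X = 1 + 2 * Polynomial.order r Y" using eq by simp
  then show False by presburger
qed

context bipyramid_motion
begin

text \<open>The roots of \<open>D i\<close> are the values of \<open>t\<close> for which the triangle over the axis with apex \<open>i\<close>
  is flat.\<close>

lemma D_roots:
  obtains r r' where "r \<noteq> r'" "D i = Polynomial.smult (- 1/4) ([:- r, 1:] * [:- r', 1:])"
    "r + r' = 2 * (a i + b i)" "r * r' = (\<beta> i)\<^sup>2"
proof -
  define l m where "l = lam {Equator i, Top}" and "m = lam {Equator i, Bottom}"
  have lm: "l > 0" "m > 0" "a i = l\<^sup>2" "b i = m\<^sup>2"
    using lengths_positive[of i] by (simp_all add: l_def m_def a_def b_def)
  show thesis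
  proof
    have "(l + m)\<^sup>2 - (l - m)\<^sup>2 = 4 * (l * m)" by (simp add: power2_eq_square algebra_simps)
    then show "(l + m)\<^sup>2 \<noteq> (l - m)\<^sup>2" using lm by auto
    show "D i = Polynomial.smult (- 1/4) ([:- (l + m)\<^sup>2, 1:] * [:- (l - m)\<^sup>2, 1:])"
      by (simp add: D_def \<beta>_def lm power2_eq_square field_simps)
    show "(l + m)\<^sup>2 + (l - m)\<^sup>2 = 2 * (a i + b i)" "(l + m)\<^sup>2 * (l - m)\<^sup>2 = (\<beta> i)\<^sup>2"
      by (simp_all add: \<beta>_def lm power2_eq_square algebra_simps)
  qed
qed

text \<open>All roots of \<open>D i\<close> and \<open>D j\<close> are simple, so if their quotient
  is a square, they have the same roots. Sum and product of the roots are the two compared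
  quantities.\<close>

lemma D_eq_if_square_quotient:
  assumes "D i * X\<^sup>2 = D j * Y\<^sup>2" "X \<noteq> 0" "Y \<noteq> 0"
  shows "a i + b i = a j + b j" "(\<beta> i)\<^sup>2 = (\<beta> j)\<^sup>2"
proof -
  obtain r r' where i: "r \<noteq> r'" "D i = Polynomial.smult (- 1/4) ([:- r, 1:] * [:- r', 1:])"
    "r + r' = 2 * (a i + b i)" "r * r' = (\<beta> i)\<^sup>2" by (rule D_roots)
  obtain z z' where j: "z \<noteq> z'" "D j = Polynomial.smult (- 1/4) ([:- z, 1:] * [:- z', 1:])"
    "z + z' = 2 * (a j + b j)" "z * z' = (\<beta> j)\<^sup>2" by (rule D_roots)
  have "Polynomial.order z (D j) = 1"
    unfolding j(2) using j(1) by (intro order_linear_product) auto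
  moreover have "Polynomial.order z' (D j) = 1"
  proof -
    have "D j = Polynomial.smult (- 1/4) ([:- z', 1:] * [:- z, 1:])" unfolding j(2) by (simp only: mult.commute)
    then show ?thesis using j(1) order_linear_product[of "- 1/4" z' z] by simp
  qed
  ultimately have "poly (D i) z = 0" "poly (D i) z' = 0"
    using assms by (auto intro!: root_if_quotient_square[OF assms(1)])
  moreover have "poly (D i) y = - ((y - r) * (y - r')) / 4" for y
    unfolding i(2) by (simp add: field_simps)
  ultimately have "{z, z'} = {r, r'}" using i(1) j(1) by auto
  then have "z + z' = r + r'" "z * z' = r * r'" using i(1) j(1) by (auto simp: doubleton_eq_iff)
  then show "a i + b i = a j + b j" "(\<beta> i)\<^sup>2 = (\<beta> j)\<^sup>2" using i j by simp_all
qed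

lemma generic_poly_nonzero: "[:0, 1:] * (\<Prod>j\<in>UNIV. D j * N j) \<noteq> 0"
  by simp

end

text \<open>Only finitely many values of \<open>t\<close> are excluded, so factors
  \<open>tb\<close>, \<open>D j\<close> and \<open>N j\<close> may be cancelled pointwise while
  conclusions still spread to all of \<open>M\<close>.\<close>

locale generic_motion_point = motion_point +
  assumes tb_nonzero: "tb (cm_map \<rho>) \<noteq> 0"
    and D_nonzero_at: "poly (D j) (tb (cm_map \<rho>)) \<noteq> 0"
    and N_nonzero_at: "poly (N j) (tb (cm_map \<rho>)) \<noteq> 0"

context bipyramid_motion
begin

lemma generic_motion_pointI:
  assumes "induces \<rho> lam" "cm_map \<rho> \<in> M" "poly ([:0, 1:] * (\<Prod>j\<in>UNIV. D j * N j)) (tb (cm_map \<rho>)) \<noteq> 0"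
  shows "generic_motion_point lam M \<rho>"
  using assms by unfold_locales (auto simp: poly_prod)

lemma vanishing_if_vanishing_generically:
  assumes "real_polynomial_function f"
    and "\<And>\<rho>. generic_motion_point lam M \<rho> \<Longrightarrow> f (cm_map \<rho>) = 0"
  shows "\<forall>p\<in>M. f p = 0"
  using vanishing_if_vanishing_at_realizations[OF assms(1) generic_poly_nonzero] assms(2)
    generic_motion_pointI by blast

lemma poly_zero_if_zero_generically:
  assumes "\<And>\<rho>. generic_motion_point lam M \<rho> \<Longrightarrow> poly r (tb (cm_map \<rho>)) = 0"
  shows "r = 0"
  using poly_zero_if_zero_at_realizations[OF generic_poly_nonzero] assms
    generic_motion_pointI by blast

lemma dcoord_not_generically_constant:
  assumes "v \<noteq> w" "{v, w} \<notin> edges"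
    and "\<And>\<rho>. generic_motion_point lam M \<rho> \<Longrightarrow> dcoord v w (cm_map \<rho>) = c"
  shows False
proof -
  have "\<forall>p\<in>M. dcoord v w p - c = 0"
    by (rule vanishing_if_vanishing_generically)
      (use assms(3) in \<open>auto intro!: real_polynomial_function_diff real_polynomial_function_dcoord
        real_polynomial_function.intros(2)\<close>)
  then show False
    using nonconstant[OF assms(1,2)] by (auto simp: constant_on_def)
qed

text \<open>The core of the argument: the vertices \<open>i\<close>, \<open>i + 2\<close>, \<open>Top\<close>, \<open>Bottom\<close> cannot remain coplanar.
  Otherwise \<open>i\<close> and \<open>i + 2\<close> coincide, or they are mirror images with respect to the plane that bisects
  the axis; in the second case \<open>i + 3\<close> or \<open>i + 4\<close> lies in this plane, so that one of the diagonals
  \<open>{i, i + 3}\<close> and \<open>{i + 2, i + 4}\<close> has constant length.\<close>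

lemma not_coplanar:
  "\<not> (\<forall>p\<in>M. poly (N i) (tb p) * scoord (i + 1) p + poly (N (i + 1)) (tb p) * scoord i p = 0)"
proof
  assume planar: "\<forall>p\<in>M. poly (N i) (tb p) * scoord (i + 1) p + poly (N (i + 1)) (tb p) * scoord i p = 0"
  have point: "vol (\<rho> Top - \<rho> Bottom) (\<rho> (Equator i) - \<rho> Bottom) (\<rho> (Equator (i + 2)) - \<rho> Bottom) = 0"
    "dotp i (i + 2) (cm_map \<rho>) * poly (N (i + 1)) (tb (cm_map \<rho>)) =
      poly (D (i + 2)) (tb (cm_map \<rho>)) * poly (N i) (tb (cm_map \<rho>))"
    "(dotp i (i + 2) (cm_map \<rho>))\<^sup>2 = poly (D (i + 2)) (tb (cm_map \<rho>)) * poly (D i) (tb (cm_map \<rho>))"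
    if "generic_motion_point lam M \<rho>" for \<rho>
  proof -
    interpret generic_motion_point lam M \<rho> by (rule that)
    \<comment> \<open>By \<open>dot_vol\<close> across \<open>i + 1\<close>, the expression assumed
      to vanish is this volume up to a factor that is nonzero at generic points.\<close>
    have "poly (D (i + 1)) (tb p) * vol u (x i) (x (i + 2)) =
        6 * (poly (N i) (tb p) * scoord (i + 1) p + poly (N (i + 1)) (tb p) * scoord i p)"
      using dot_vol[of u "x i" "x (i + 1)" "x (i + 2)"] dot_x_edge[of i] dot_x_edge[of "i + 1"]
        vol_x_edge[of i] vol_x_edge[of "i + 1"] dot_x_x[of "i + 1"]
      by (simp add: add_mod5 distrib_left mult_ac)
    then show V: "vol u (x i) (x (i + 2)) = 0"
      using planar \<rho>M D_nonzero_at by simp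
    show "dotp i (i + 2) p * poly (N (i + 1)) (tb p) = poly (D (i + 2)) (tb p) * poly (N i) (tb p)"
      using dot_dot[of u "x i" "x (i + 2)" "x (i + 1)"] V dot_x_edge[of i] dot_x_edge[of "i + 1"]
        dot_x_x[of "i + 2"] dot_x[of i "i + 2"] dot_commute[of u "x (i + 2)" "x (i + 1)"]
      by (simp add: add_mod5)
    show "(dotp i (i + 2) p)\<^sup>2 = poly (D (i + 2)) (tb p) * poly (D i) (tb p)"
      using dot_dot[of u "x i" "x (i + 2)" "x i"] V dot_x_x[of i]
        dot_x_x[of "i + 2"] dot_x[of i "i + 2"] dot_commute[of u "x (i + 2)" "x i"]
      by (simp add: power2_eq_square)
  qed
  \<comment> \<open>Eliminating \<open>dotp i (i + 2)\<close> from the last two relations of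
    \<open>point\<close> exhibits the quotient of \<open>D i\<close> and \<open>D (i + 2)\<close> as
    a square.\<close>
  have "D i * (N (i + 1))\<^sup>2 - D (i + 2) * (N i)\<^sup>2 = 0"
  proof (rule poly_zero_if_zero_generically)
    fix \<rho> assume g: "generic_motion_point lam M \<rho>"
    then interpret generic_motion_point lam M \<rho> .
    have "poly (D (i + 2)) (tb p) * (poly (D i) (tb p) * (poly (N (i + 1)) (tb p))\<^sup>2) =
      (dotp i (i + 2) p * poly (N (i + 1)) (tb p))\<^sup>2"
      using point(3)[OF g] by (simp add: power_mult_distrib)
    also have "\<dots> = poly (D (i + 2)) (tb p) * (poly (D (i + 2)) (tb p) * (poly (N i) (tb p))\<^sup>2)"
      unfolding point(2)[OF g] by (simp add: power2_eq_square)
    finally show "poly (D i * (N (i + 1))\<^sup>2 - D (i + 2) * (N i)\<^sup>2) (tb p) = 0"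
      using D_nonzero_at[of "i + 2"] by simp
  qed
  then have sq: "D i * (N (i + 1))\<^sup>2 = D (i + 2) * (N i)\<^sup>2" by simp
  then have ab: "a i + b i = a (i + 2) + b (i + 2)" and \<beta>\<beta>: "(\<beta> i)\<^sup>2 = (\<beta> (i + 2))\<^sup>2"
    using D_eq_if_square_quotient[OF sq N_nonzero N_nonzero] by auto
  have D: "D (i + 2) = D i"
  proof -
    have "b (i + 2) - \<beta> (i + 2) / 2 = b i - \<beta> i / 2" using ab by (simp add: \<beta>_def field_simps)
    then show ?thesis unfolding D_def using \<beta>\<beta> by simp
  qed
  then have "(N (i + 1))\<^sup>2 = (N i)\<^sup>2" using sq by simp
  then have "N (i + 1) = N i \<or> N (i + 1) = - N i" by (simp add: power2_eq_iff)
  \<comment> \<open>Both polynomials have leading coefficient \<open>- 1/4\<close>, so opposite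
    signs are impossible.\<close>
  then have N: "N (i + 1) = N i" by (auto simp: N_def)
  have dotp_D: "dotp i (i + 2) (cm_map \<rho>) = poly (D i) (tb (cm_map \<rho>))"
    if "generic_motion_point lam M \<rho>" for \<rho>
    using point(2)[OF that] generic_motion_point.N_nonzero_at[OF that, of i] by (simp add: D N)
  have D_val: "poly (D j) y = y * b j - (y + \<beta> j)\<^sup>2 / 4" for j y
    by (simp add: D_def power2_eq_square field_simps)
  show False
  \<comment> \<open>By \<open>dotp_D\<close> the vertices \<open>i\<close> and \<open>i + 2\<close>
    have the same projection along the axis. Equal heights make them coincide, opposite heights make
    them mirror images.\<close>
  proof (cases "\<beta> (i + 2) = \<beta> i")
    case True
    then have "b (i + 2) = b i" using ab by (simp add: \<beta>_def)
    show False
    proof (rule dcoord_not_generically_constant)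
      fix \<rho> assume g: "generic_motion_point lam M \<rho>"
      then interpret generic_motion_point lam M \<rho> .
      have "tb p * dcoord (Equator i) (Equator (i + 2)) p = 0"
        using dotp_D[OF g] unfolding dotp_def D_val True \<open>b (i + 2) = b i\<close>
        by (simp add: power2_eq_square field_simps)
      then show "dcoord (Equator i) (Equator (i + 2)) p = 0" using tb_nonzero by simp
    qed (use nonedges in simp_all)
  next
    case False
    then have \<beta>: "\<beta> (i + 2) = - \<beta> i" "\<beta> i \<noteq> 0"
      using \<beta>\<beta> by (auto simp: power2_eq_iff)
    have bb: "b (i + 2) = b i - \<beta> i" using ab \<beta>(1) by (simp add: \<beta>_def)
    have N14: "dotp i (i + 3) (cm_map \<rho>) = poly (N (i + 2)) (tb (cm_map \<rho>))"
      and N53: "dotp (i + 4) (i + 2) (cm_map \<rho>) = poly (N (i + 4)) (tb (cm_map \<rho>))"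
      if g: "generic_motion_point lam M \<rho>" for \<rho>
    proof -
      interpret generic_motion_point lam M \<rho> by (rule g)
      have "dotp i (i + 2) p * poly (N (i + 2)) (tb p) = poly (D (i + 2)) (tb p) * dotp i (i + 3) p"
        using dot_dot[of u "x i" "x (i + 2)" "x (i + 3)"] point(1)[OF g] dot_x_edge[of "i + 2"]
          dot_x_x[of "i + 2"] dot_x[of i "i + 2"] dot_x[of i "i + 3"]
        by (simp add: add_mod5)
      then show "dotp i (i + 3) p = poly (N (i + 2)) (tb p)"
        using D_nonzero_at[of i] by (simp add: D dotp_D[OF g])
      have "poly (N (i + 4)) (tb p) * dotp i (i + 2) p = poly (D i) (tb p) * dotp (i + 4) (i + 2) p"
        using dot_dot[of u "x (i + 4)" "x i" "x (i + 2)"] point(1)[OF g] dot_x_edge[of "i + 4"]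
          dot_x_x[of i] dot_x[of i "i + 2"] dot_x[of "i + 4" "i + 2"]
        by (simp add: add_mod5)
      then show "dotp (i + 4) (i + 2) p = poly (N (i + 4)) (tb p)"
        using D_nonzero_at[of i] by (simp add: dotp_D[OF g])
    qed
    \<comment> \<open>Gram determinant of the projections of \<open>i\<close>, \<open>i + 3\<close>
      and \<open>i + 4\<close>. As \<open>i\<close> and \<open>i + 2\<close> project to the same
      point, the entry of the diagonal from \<open>i\<close> to \<open>i + 3\<close> becomes
      \<open>N (i + 2)\<close>, and the determinant is a polynomial in \<open>t\<close>.\<close>
    let ?P = "D i * D (i + 3) * D (i + 4) + 2 * N (i + 2) * N (i + 3) * N (i + 4) -
      (D i * (N (i + 3))\<^sup>2 + D (i + 3) * (N (i + 4))\<^sup>2 + D (i + 4) * (N (i + 2))\<^sup>2)"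
    have "?P = 0"
    proof (rule poly_zero_if_zero_generically)
      fix \<rho> assume g: "generic_motion_point lam M \<rho>"
      then interpret generic_motion_point lam M \<rho> .
      show "poly ?P (tb p) = 0"
        using dot_gram[of u "x (i + 3)" "x i" "x (i + 4)"] dot_x_x[of "i + 3"] D_nonzero_at[of "i + 3"]
          dot_x_x[of i] dot_x_x[of "i + 4"] dot_x[of i "i + 3"] N14[OF g] dot_x_edge[of "i + 3"]
          dot_x_edge[of "i + 4"] dot_commute[of u "x i" "x (i + 4)"]
        by (simp add: add_mod5 mult_ac)
    qed
    then have "poly ?P 0 = 0" by simp
    moreover have five: "(5::5) = 0" by simp
    \<comment> \<open>At \<open>t = 0\<close> every entry is minus a product of two heights over 4,
      a matrix of rank one, except that \<open>\<beta> (i + 2) = - \<beta> i\<close> flips the sign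
      of \<open>N (i + 2)\<close>. The terms then add up to \<open>- 1 + 2 + 3 = 4\<close>
      sixty-fourths instead of cancelling.\<close>
    have "poly ?P 0 = (\<beta> i * \<beta> (i + 3) * \<beta> (i + 4))\<^sup>2 / 16"
      unfolding poly_diff poly_add poly_mult poly_power
      by (simp add: D_def N_def add_mod5 five \<beta>(1) power2_eq_square field_simps)
    ultimately have "\<beta> i * \<beta> (i + 3) * \<beta> (i + 4) = 0" by (metis divide_eq_0_iff power_eq_0_iff zero_neq_numeral)
    then consider "\<beta> (i + 3) = 0" | "\<beta> (i + 4) = 0" using \<beta>(2) by auto
    then show False
    proof cases
      case 1
      show False
      proof (rule dcoord_not_generically_constant)
        fix \<rho> assume g: "generic_motion_point lam M \<rho>"
        then interpret generic_motion_point lam M \<rho> .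
        \<comment> \<open>A point of the bisecting plane is equally far from the mirror images
          \<open>i\<close> and \<open>i + 2\<close>.\<close>
        have "tb p * dcoord (Equator i) (Equator (i + 3)) p = tb p * e (i + 2)"
          using N14[OF g] unfolding dotp_def N_def bb \<beta>(1)
          by (auto simp: 1 add_mod5 field_simps)
        then show "dcoord (Equator i) (Equator (i + 3)) p = e (i + 2)" using tb_nonzero by simp
      qed (use nonedges in simp_all)
    next
      case 2
      show False
      proof (rule dcoord_not_generically_constant)
        fix \<rho> assume g: "generic_motion_point lam M \<rho>"
        then interpret generic_motion_point lam M \<rho> .
        have "tb p * dcoord (Equator (i + 4)) (Equator (i + 2)) p = tb p * e (i + 4)"
          using N53[OF g] unfolding dotp_def N_def bb \<beta>(1)
          by (auto simp: 2 add_mod5 five field_simps)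
        then show "dcoord (Equator (i + 2)) (Equator (i + 4)) p = e (i + 4)"
          using tb_nonzero by (simp add: dcoord_commute)
      qed (use nonedges(2)[of "i + 2"] in \<open>simp_all add: add_mod5\<close>)
    qed
  qed
qed

text \<open>Both sides express the volume of \<open>(i, i + 2, Top, Bottom)\<close>, along the two arcs of the equator
  from \<open>i\<close> to \<open>i + 2\<close>.\<close>

lemma closing_condition:
  "\<forall>p\<in>M. poly (D (i + 3) * D (i + 4) * N i) (tb p) * scoord (i + 1) p
      + poly (D (i + 3) * D (i + 4) * N (i + 1)) (tb p) * scoord i p =
    poly (- D (i + 1)) (tb p) *
     ((poly (N (i + 2) * N (i + 3)) (tb p) + poly [:0, - 36:] (tb p) * (scoord (i + 2) p * scoord (i + 3) p)) * scoord (i + 4) p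
      + (poly (N (i + 2)) (tb p) * scoord (i + 3) p + poly (N (i + 3)) (tb p) * scoord (i + 2) p) * poly (N (i + 4)) (tb p))"
  (is "\<forall>p\<in>M. ?L p = ?R p")
proof -
  have "\<forall>p\<in>M. ?L p - ?R p = 0"
  proof (rule vanishing_if_vanishing_generically)
    show "real_polynomial_function (\<lambda>p. ?L p - ?R p)"
      by (intro real_polynomial_function_diff real_polynomial_function.intros(3,4)
          real_polynomial_function_poly real_polynomial_function_scoord t_poly)
    fix \<rho> assume "generic_motion_point lam M \<rho>"
    then interpret generic_motion_point lam M \<rho> .
    define N0 N1 N2 N3 N4 where "N0 = poly (N i) (tb p)" and "N1 = poly (N (i + 1)) (tb p)"
      and "N2 = poly (N (i + 2)) (tb p)" and "N3 = poly (N (i + 3)) (tb p)" and "N4 = poly (N (i + 4)) (tb p)"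
    define D1 D3 D4 where "D1 = poly (D (i + 1)) (tb p)" and "D3 = poly (D (i + 3)) (tb p)"
      and "D4 = poly (D (i + 4)) (tb p)"
    define s0 s1 s2 s3 s4 where "s0 = scoord i p" and "s1 = scoord (i + 1) p" and "s2 = scoord (i + 2) p"
      and "s3 = scoord (i + 3) p" and "s4 = scoord (i + 4) p"
    note defs = N0_def N1_def N2_def N3_def N4_def D1_def D3_def D4_def s0_def s1_def s2_def s3_def s4_def
    define W V T where "W = vol u (x i) (x (i + 2))" and "V = vol u (x (i + 2)) (x (i + 4))"
      and "T = dot u (x (i + 2)) (x (i + 4))"
    have 1: "N0 * (6 * s1) + 6 * s0 * N1 = D1 * W"
      using dot_vol[of u "x i" "x (i + 1)" "x (i + 2)"] dot_x_edge[of i] dot_x_edge[of "i + 1"]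
        vol_x_edge[of i] vol_x_edge[of "i + 1"] dot_x_x[of "i + 1"]
      by (simp add: add_mod5 defs W_def)
    have 2: "N2 * (6 * s3) + 6 * s2 * N3 = D3 * V"
      using dot_vol[of u "x (i + 2)" "x (i + 3)" "x (i + 4)"] dot_x_edge[of "i + 2"] dot_x_edge[of "i + 3"]
        vol_x_edge[of "i + 2"] vol_x_edge[of "i + 3"] dot_x_x[of "i + 3"]
      by (simp add: add_mod5 defs V_def)
    have 3: "N2 * N3 - tb p * (6 * s2 * (6 * s3)) = D3 * T"
      using dot_dot[of u "x (i + 2)" "x (i + 3)" "x (i + 4)"] dot_x_edge[of "i + 2"] dot_x_edge[of "i + 3"]
        vol_x_edge[of "i + 2"] vol_x_edge[of "i + 3"] dot_x_x[of "i + 3"] axis_square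
      by (simp add: add_mod5 defs T_def)
    \<comment> \<open>The long arc runs from \<open>i + 2\<close> to \<open>i\<close>, so it yields
      the volume with the opposite sign; this is the origin of the minus sign in front of
      \<open>D (i + 1)\<close>.\<close>
    have 4: "T * (6 * s4) + V * N4 = D4 * (- W)"
      using dot_vol[of u "x (i + 2)" "x (i + 4)" "x i"] dot_x_edge[of "i + 4"] vol_x_edge[of "i + 4"]
        dot_x_x[of "i + 4"] vol_commute[of u "x (i + 2)" "x i"]
      by (simp add: add_mod5 defs T_def V_def W_def)
    have "6 * (D3 * D4 * (N0 * s1 + N1 * s0)) = D1 * D3 * (D4 * W)"
      using arg_cong[OF 1, of "\<lambda>z. D3 * D4 * z"] by (simp add: algebra_simps)
    also have "\<dots> = - D1 * (D3 * T * (6 * s4) + D3 * V * N4)"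
      using arg_cong[OF 4, of "\<lambda>z. D1 * D3 * z"] by (simp add: algebra_simps)
    also have "\<dots> = - 6 * D1 * ((N2 * N3 - 36 * tb p * (s2 * s3)) * s4 + (N2 * s3 + N3 * s2) * N4)"
      unfolding 2[symmetric] 3[symmetric] by (simp add: algebra_simps)
    finally have "D3 * D4 * (N0 * s1 + N1 * s0) =
      - D1 * ((N2 * N3 - 36 * tb p * (s2 * s3)) * s4 + (N2 * s3 + N3 * s2) * N4)"
      by simp
    then have "D3 * D4 * N0 * s1 + D3 * D4 * N1 * s0 -
      - D1 * ((N2 * N3 + (- 36 * tb p) * (s2 * s3)) * s4 + (N2 * s3 + N3 * s2) * N4) = 0"
      by (simp add: algebra_simps)
    then show "?L p - ?R p = 0"
      unfolding defs by (simp add: mult.commute[of "tb p"])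
  qed
  then show ?thesis by (simp only: right_minus_eq)
qed

text \<open>The right-hand side of \<open>closing_condition\<close> is fixed by
  \<open>\<phi>\<close>, hence so is the left-hand side. If one of its two volumes changes sign,
  that volume vanishes; if both do, the whole left-hand side vanishes, contrary to
  \<open>not_coplanar\<close>.\<close>

lemma no_adjacent_sign_changes:
  assumes \<phi>: "\<phi> \<in> galois_automorphisms F (base_field M)"
    and fixed: "sign \<phi> (i + 2) = 1" "sign \<phi> (i + 3) = 1" "sign \<phi> (i + 4) = 1"
  shows "sign \<phi> i = 1" "sign \<phi> (i + 1) = 1"
proof -
  note P = corresponds_poly[OF \<phi>] and A = corresponds_add[OF \<phi>] and Mu = corresponds_mult[OF \<phi>]
  have S: "corresponds \<phi> (scoord j) (scoord j)" if "sign \<phi> j = 1" for j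
    using corresponds_scoord[OF \<phi>, of j] that by simp
  let ?A = "\<lambda>p. poly (D (i + 3) * D (i + 4) * N i) (tb p)"
  let ?B = "\<lambda>p. poly (D (i + 3) * D (i + 4) * N (i + 1)) (tb p)"
  let ?C = "\<lambda>p. poly (- D (i + 1)) (tb p) *
     ((poly (N (i + 2) * N (i + 3)) (tb p) + poly [:0, - 36:] (tb p) * (scoord (i + 2) p * scoord (i + 3) p)) * scoord (i + 4) p
      + (poly (N (i + 2)) (tb p) * scoord (i + 3) p + poly (N (i + 3)) (tb p) * scoord (i + 2) p) * poly (N (i + 4)) (tb p))"
  have L: "corresponds \<phi> (\<lambda>p. ?A p * scoord (i + 1) p + ?B p * scoord i p)
    (\<lambda>p. ?A p * (sign \<phi> (i + 1) * scoord (i + 1) p) + ?B p * (sign \<phi> i * scoord i p))"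
    by (intro A Mu P corresponds_scoord[OF \<phi>])
  have R: "corresponds \<phi> ?C ?C"
    by (intro A Mu P S fixed)
  have eq: "\<forall>p\<in>M. ?A p * (sign \<phi> (i + 1) * scoord (i + 1) p) + ?B p * (sign \<phi> i * scoord i p) =
      ?A p * scoord (i + 1) p + ?B p * scoord i p"
    using corresponds_unique[OF \<phi> L R closing_condition] closing_condition[of i] by simp
  have nz: "D (i + 3) * D (i + 4) * N j \<noteq> 0" for j by simp
  have single: "\<not> (\<forall>p\<in>M. poly (D (i + 3) * D (i + 4) * N j) (tb p) * scoord k p = 0)" for j k
    using cancel_poly_t[OF nz real_polynomial_function_scoord] scoord_nonzero by blast
  have cases: "sign \<phi> i = 1 \<and> sign \<phi> (i + 1) = 1"
  proof (rule ccontr)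
    assume "\<not> ?thesis"
    then consider "sign \<phi> i = - 1" "sign \<phi> (i + 1) = 1" | "sign \<phi> i = 1" "sign \<phi> (i + 1) = - 1"
      | "sign \<phi> i = - 1" "sign \<phi> (i + 1) = - 1"
      using sign_cases[OF \<phi>] by metis
    then show False
    proof cases
      case 1
      then have "\<forall>p\<in>M. ?B p * scoord i p = 0" using eq by simp
      then show False using single by blast
    next
      case 2
      then have "\<forall>p\<in>M. ?A p * scoord (i + 1) p = 0" using eq by simp
      then show False using single by blast
    next
      case 3
      have "\<forall>p\<in>M. poly (D (i + 3) * D (i + 4)) (tb p) *
        (poly (N i) (tb p) * scoord (i + 1) p + poly (N (i + 1)) (tb p) * scoord i p) = 0"
      proof
        fix p assume "p \<in> M"
        from eq[rule_format, OF this, unfolded 3]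
        have "?A p * scoord (i + 1) p + ?B p * scoord i p = 0"
          unfolding mult_minus1 mult_minus_right by linarith
        then show "poly (D (i + 3) * D (i + 4)) (tb p) *
          (poly (N i) (tb p) * scoord (i + 1) p + poly (N (i + 1)) (tb p) * scoord i p) = 0"
          by (simp add: algebra_simps)
      qed
      then have "\<forall>p\<in>M. poly (N i) (tb p) * scoord (i + 1) p + poly (N (i + 1)) (tb p) * scoord i p = 0"
        by (rule cancel_poly_t[rotated 2])
          (simp, intro real_polynomial_function.intros(3,4) real_polynomial_function_poly
            real_polynomial_function_scoord t_poly)
      then show False using not_coplanar by blast
    qed
  qed
  then show "sign \<phi> i = 1" "sign \<phi> (i + 1) = 1" by simp_all
qed

lemma galois_group_adjacent:
  assumes g: "g \<in> galois_group M" and 0: "g $ (i + 2) = 0" "g $ (i + 3) = 0" "g $ (i + 4) = 0"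
  shows "g = 0"
proof -
  obtain \<phi> where \<phi>: "\<phi> \<in> galois_automorphisms F (base_field M)" "g = sign_tuple M \<phi>"
    using g by (auto simp: galois_group_def)
  have s: "sign \<phi> j = 1 \<longleftrightarrow> g $ j = 0" for j
    by (simp add: sign_def[OF \<phi>(1)] \<phi>(2))
  have z: "g $ i = 0" "g $ (i + 1) = 0"
    using no_adjacent_sign_changes[OF \<phi>(1), of i] 0 unfolding s by blast+
  then have "g $ j = 0" for j using mod5_offset[of j i] 0 by auto
  then show ?thesis by (simp add: vec_eq_iff)
qed

end

theorem proposition3p19:
  fixes lam :: "vertex set \<Rightarrow> real" and M :: "cm_space set"
  assumes "nondegenerate_motion lam M"
  shows "\<exists>\<sigma>\<in>dihedral.
    relabel \<sigma> ` galois_group M = group_closure {vector [1, 1, 1, 1, 1]} \<or>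
    relabel \<sigma> ` galois_group M = group_closure {vector [1, 1, 1, 1, 1], vector [1, 0, 1, 0, 0]}"
proof -
  interpret bipyramid_motion lam M by standard (rule assms)
  show ?thesis
    by (rule sign_group_classification)
      (fact all_ones_galois galois_group_add galois_group_adjacent)+
qed

end
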